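(* Let $\mathcal H$ be a real Hilbert space, let $A:\mathcal H\to 2^{\mathcal H}$ be a maximally monotone operator such that $S=A^{-1}(0)\neq\emptyset$, and let $t_0>0$. Let $\alpha>2$ and $\lambda(t)=(1+\epsilon)\frac{t^2}{\alpha^2}$ with $\epsilon>\frac{4}{\alpha-2}$. Let $f:[t_0,+\infty[\to\mathcal H$ be locally integrable with $\int_{t_0}^{+\infty}t^3\|f(t)\|^2\,dt<+\infty$ and $\int_{t_0}^{+\infty}t\|f(t)\|\,dt<+\infty$. Let $x:[t_0,+\infty[\to\mathcal H$ be a solution of $$\ddot x(t)+\frac{\alpha}{t}\dot x(t)+A_{\lambda(t)}(x(t))=f(t).$$ Then $x(t)$ converges weakly, as $t\to+\infty$, to an element of $S$. Moreover $\|\dot x(t)\|=\mathcal O(1/t)$.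
   Context: For $\lambda>0$, $A_\lambda=\frac1\lambda\left(I-(I+\lambda A)^{-1}\right)$ is the Yosida regularization of $A$ with index $\lambda$. $S=A^{-1}(0)=\{z\in\mathcal H:0\in Az\}$. A solution is a strong global solution: $x$ is continuously differentiable, $\dot x$ is locally absolutely continuous, and the equation holds for almost every $t>t_0$. *)

theory Defs
  imports "HOL-Analysis.Analysis" "HOL-Library.Landau_Symbols"
begin

section \<open>Maximally monotone operators and the Yosida regularization\<close>

text \<open>
  A set-valued operator on \<open>\<H>\<close> is a function \<open>'a \<Rightarrow> 'a set\<close>. A real Hilbert space, of arbitrary
  dimension and not necessarily separable, is a type of sort \<open>{real_inner, complete_space}\<close>.
\<close>

definition monotone_op :: "('a::real_inner \<Rightarrow> 'a set) \<Rightarrow> bool" where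
  "monotone_op A \<longleftrightarrow> (\<forall>x y. \<forall>u\<in>A x. \<forall>v\<in>A y. 0 \<le> (x - y) \<bullet> (u - v))"

definition maximally_monotone_op :: "('a::real_inner \<Rightarrow> 'a set) \<Rightarrow> bool" where
  "maximally_monotone_op A \<longleftrightarrow>
     monotone_op A \<and> (\<forall>B. monotone_op B \<and> (\<forall>x. A x \<subseteq> B x) \<longrightarrow> B = A)"

definition op_inverse :: "('a \<Rightarrow> 'b set) \<Rightarrow> 'b \<Rightarrow> 'a set" where
  "op_inverse T y = {x. y \<in> T x}"

text \<open>
  For maximally monotone \<open>A\<close> and \<open>\<mu> > 0\<close>, the set \<open>(I + \<mu>A)\<^sup>-\<^sup>1 x\<close> is a singleton
  (Minty's theorem), so the resolvent is a function; for other arguments its value is unspecified.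
\<close>

definition resolvent :: "('a::real_vector \<Rightarrow> 'a set) \<Rightarrow> real \<Rightarrow> 'a \<Rightarrow> 'a" where
  "resolvent A \<mu> x = (THE z. z \<in> op_inverse (\<lambda>y. {y + \<mu> *\<^sub>R u | u. u \<in> A y}) x)"

definition yosida :: "('a::real_vector \<Rightarrow> 'a set) \<Rightarrow> real \<Rightarrow> 'a \<Rightarrow> 'a" where
  "yosida A \<mu> x = (1 / \<mu>) *\<^sub>R (x - resolvent A \<mu> x)"

section \<open>Weak convergence\<close>

definition weakly_tendsto :: "('b \<Rightarrow> 'a::real_inner) \<Rightarrow> 'a \<Rightarrow> 'b filter \<Rightarrow> bool" where
  "weakly_tendsto x z F \<longleftrightarrow> (\<forall>y. ((\<lambda>t. x t \<bullet> y) \<longlongrightarrow> z \<bullet> y) F)"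

section \<open>Local integrability\<close>

text \<open>
  The library's \<^const>\<open>integrable\<close> requires the codomain to be second countable, which would force
  the Hilbert space to be separable. Here is its definition without this restriction; the
  convergence of the integrals of the simple functions, which \<^const>\<open>has_bochner_integral\<close> also
  records, is automatic in a complete space.
\<close>

definition bochner_integrable :: "'b measure \<Rightarrow> ('b \<Rightarrow> 'a::real_normed_vector) \<Rightarrow> bool" where
  "bochner_integrable M f \<longleftrightarrow>
     f \<in> borel_measurable M \<and>
     (\<exists>s. (\<forall>i::nat. Bochner_Integration.simple_bochner_integrable M (s i)) \<and>
          (\<lambda>i. \<integral>\<^sup>+ x. ennreal (norm (f x - s i x)) \<partial>M) \<longlonglongrightarrow> 0)"

definition locally_integrable_on :: "(real \<Rightarrow> 'a::real_normed_vector) \<Rightarrow> real set \<Rightarrow> bool" where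
  "locally_integrable_on f S \<longleftrightarrow>
     (\<forall>a b. {a..b} \<subseteq> S \<longrightarrow> bochner_integrable lebesgue (\<lambda>t. indicator {a..b} t *\<^sub>R f t))"

section \<open>Absolute continuity\<close>

definition absolutely_continuous_on_Icc ::
    "real \<Rightarrow> real \<Rightarrow> (real \<Rightarrow> 'a::real_normed_vector) \<Rightarrow> bool" where
  "absolutely_continuous_on_Icc a b g \<longleftrightarrow>
     (\<forall>\<epsilon>>0. \<exists>\<delta>>0. \<forall>(n::nat) l r.
        (\<forall>k<n. a \<le> l k \<and> l k \<le> r k \<and> r k \<le> b) \<and>
        disjoint_family_on (\<lambda>k. {l k<..<r k}) {..<n} \<and>
        (\<Sum>k<n. r k - l k) < \<delta>
        \<longrightarrow> (\<Sum>k<n. norm (g (r k) - g (l k))) < \<epsilon>)"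

definition locally_absolutely_continuous_on ::
    "real set \<Rightarrow> (real \<Rightarrow> 'a::real_normed_vector) \<Rightarrow> bool" where
  "locally_absolutely_continuous_on S g \<longleftrightarrow>
     (\<forall>a b. {a..b} \<subseteq> S \<longrightarrow> absolutely_continuous_on_Icc a b g)"

section \<open>Strong global solutions\<close>

text \<open>
  Trajectories and forcing terms are total functions of which only the values on \<open>{t\<^sub>0..}\<close> matter.
  The derivative at the endpoint \<open>t\<^sub>0\<close> is one-sided.
\<close>

definition velocity :: "real \<Rightarrow> (real \<Rightarrow> 'a::real_normed_vector) \<Rightarrow> real \<Rightarrow> 'a" where
  "velocity t\<^sub>0 x t = vector_derivative x (at t within {t\<^sub>0..})"

definition strong_global_solution ::
    "('a::real_inner \<Rightarrow> 'a set) \<Rightarrow> real \<Rightarrow> (real \<Rightarrow> real) \<Rightarrow> (real \<Rightarrow> 'a) \<Rightarrow> real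
       \<Rightarrow> (real \<Rightarrow> 'a) \<Rightarrow> bool" where
  "strong_global_solution A \<alpha> lam f t\<^sub>0 x \<longleftrightarrow>
     x differentiable_on {t\<^sub>0..} \<and>
     continuous_on {t\<^sub>0..} (velocity t\<^sub>0 x) \<and>
     locally_absolutely_continuous_on {t\<^sub>0..} (velocity t\<^sub>0 x) \<and>
     (AE t in lebesgue. t > t\<^sub>0 \<longrightarrow>
        (\<exists>a. (velocity t\<^sub>0 x has_vector_derivative a) (at t) \<and>
             a + (\<alpha> / t) *\<^sub>R velocity t\<^sub>0 x t + yosida A (lam t) (x t) = f t))"

end

theory Submission
  imports Defs
begin

text \<open>
  Fix a zero \<open>z\<close> of \<open>A\<close>, write \<open>X = x - z\<close>, let \<open>v\<close> be the velocity, \<open>a\<close> the acceleration and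
  \<open>y = A\<^sub>\<lambda> x\<close>. Cocoercivity of the Yosida regularization gives \<open>\<langle>y, X\<rangle> \<ge> \<lambda> |y|\<^sup>2\<close>, and the
  equation says \<open>y = f - (a + (\<alpha>/t) v)\<close>. So \<open>\<lambda> |y|\<^sup>2\<close> controls, up to a multiple of \<open>t\<^sup>2 |f|\<^sup>2\<close>,
  the quantity \<open>\<lambda> |a + (\<alpha>/t) v|\<^sup>2\<close>. Because \<open>\<lambda> = (1 + \<epsilon>) t\<^sup>2/\<alpha>\<^sup>2\<close> and \<open>\<epsilon>\<close> is large enough,
  expanding that square yields a multiple of \<open>|v|\<^sup>2\<close> that outweighs the kinetic term \<open>|v|\<^sup>2\<close>
  coming from the second derivative of \<open>|X|\<^sup>2/2\<close>, and a cross term \<open>\<langle>v, a\<rangle>\<close> that is part of a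
  total derivative. Precisely, for a suitable constant \<open>c\<close> the function
  \<open>t \<langle>X, v\<rangle> + (\<alpha> - 1)/2 |X|\<^sup>2 + c t\<^sup>2 |v|\<^sup>2\<close> has derivative at most
  \<open>- (2/\<alpha>) t |v|\<^sup>2 + t \<langle>X, f\<rangle> + K t\<^sup>3 |f|\<^sup>2\<close>, and it is a positive definite quadratic form in
  \<open>(X, t v)\<close>. Integrating and comparing with the maximum of \<open>|X|\<close> shows that \<open>X\<close> and \<open>t v\<close> are
  bounded and that \<open>t |v|\<^sup>2\<close> is integrable (\<open>energy_bounds\<close>); this already contains
  \<open>|v| = O(1/t)\<close>.

  Without its last summand the function becomes \<open>t h' + (\<alpha> - 1) h\<close> with \<open>h = |X|\<^sup>2/2\<close>, and its
  derivative is at most an integrable function minus \<open>t \<lambda> |y|\<^sup>2\<close>. Hence \<open>t h' + (\<alpha> - 1) h\<close> has a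
  limit, which forces \<open>h\<close> to have one, and \<open>t \<lambda> |y|\<^sup>2\<close> is integrable
  (\<open>distance_tendsto_and_damping_bound\<close>). For the displacement \<open>\<xi> = \<lambda> y = x - (I + \<lambda> A)\<^sup>-\<^sup>1 x\<close> the
  latter says that \<open>|\<xi>|\<^sup>2\<close> is integrable with respect to \<open>dt/t\<close>. As a function of \<open>log t\<close> the
  displacement is Lipschitz, so \<open>\<xi> \<rightarrow> 0\<close> (\<open>displacement_tendsto_0\<close>). Finally \<open>(x - \<xi>, \<xi>/\<lambda>)\<close> lies in
  the graph of \<open>A\<close>, both \<open>\<xi>\<close> and \<open>\<xi>/\<lambda>\<close> tend to \<open>0\<close>, and maximality puts every weak limit point of
  \<open>x\<close> into the set of zeros. Opial's argument finishes the proof.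

  Three general facts support this. Minty's theorem makes the resolvent a function; it comes from
  minimising the Fitzpatrick function of \<open>A\<close> plus \<open>|p|\<^sup>2/2\<close>. Opial's lemma is proved without weak
  sequential compactness: the points that no half-space containing a tail of the trajectory can
  exclude play the part of weak limit points. Both rest on the fact that a decreasing sequence of
  bounded nonempty closed convex sets has a common point. The differential inequalities, which
  hold only almost everywhere, are integrated by \<open>absolutely_continuous_increment_le_integral\<close>.
\<close>

section \<open>Nested convex sets and Minty's theorem\<close>

text \<open>
  This replaces weak compactness of bounded sets. Points \<open>w n \<in> K n\<close> that almost minimise the norm
  form a Cauchy sequence: by convexity the midpoint of \<open>w n\<close> and \<open>w m\<close> is in \<open>K n\<close> for \<open>n \<le> m\<close>, so
  it is not much shorter than either of them, and the parallelogram law makes their distance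
  small.
\<close>

lemma nested_closed_convex_Inter_nonempty:
  fixes K :: "nat \<Rightarrow> 'a::{real_inner,complete_space} set"
  assumes closed: "\<And>n. closed (K n)" and convex: "\<And>n. convex (K n)"
    and dec: "decseq K" and ne: "\<And>n. K n \<noteq> {}" and bounded: "bounded (K 0)"
  shows "(\<Inter>n. K n) \<noteq> {}"
proof -
  define d where "d n = (INF w\<in>K n. (norm w)\<^sup>2)" for n
  have bdd: "bdd_below ((\<lambda>w. (norm w)\<^sup>2) ` K n)" for n
    by (rule bdd_belowI[of _ 0]) auto
  have d_le: "d n \<le> (norm w)\<^sup>2" if "w \<in> K n" for n w
    unfolding d_def by (rule cINF_lower[OF bdd that])
  obtain B where B: "\<And>w. w \<in> K 0 \<Longrightarrow> norm w \<le> B"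
    using bounded by (auto simp: bounded_iff)
  have sub: "K m \<subseteq> K n" if "n \<le> m" for n m
    using dec that by (auto simp: decseq_def)
  have d_mono: "incseq d"
    unfolding incseq_def d_def using sub bdd ne by (auto intro!: cINF_superset_mono)
  have d_bound: "d n \<le> B\<^sup>2" for n
  proof -
    obtain w where w: "w \<in> K n" using ne by auto
    with sub have "norm w \<le> B" using B by blast
    then have "(norm w)\<^sup>2 \<le> B\<^sup>2" by (simp add: power_mono)
    with d_le[OF w] show ?thesis by simp
  qed
  then obtain L where L: "d \<longlonglongrightarrow> L" "\<And>n. d n \<le> L"
    using incseq_convergent[OF d_mono] by blast
  have "\<exists>w\<in>K n. (norm w)\<^sup>2 < d n + 1 / real (Suc n)" for n
    using cINF_less_iff[OF ne bdd, of n "d n + 1 / real (Suc n)"] by (simp add: d_def)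
  then obtain w where w: "\<And>n. w n \<in> K n" "\<And>n. (norm (w n))\<^sup>2 < d n + 1 / real (Suc n)"
    by metis
  define e where "e n = 2 * (L - d n) + 4 * (1 / real (Suc n))" for n
  have e0: "e \<longlonglongrightarrow> 0"
  proof -
    have "e \<longlonglongrightarrow> 2 * (L - L) + 4 * 0"
      unfolding e_def by (intro tendsto_intros L(1) LIMSEQ_Suc[OF lim_1_over_n])
    then show ?thesis by simp
  qed
  have dist_e: "(dist (w n) (w m))\<^sup>2 \<le> e n" if "n \<le> m" for n m
  proof -
    have "(1/2) *\<^sub>R w n + (1/2) *\<^sub>R w m \<in> K n"
      using convexD[OF convex[of n], of "w n" "w m" "1/2" "1/2"] w(1) sub[OF that] by auto
    from d_le[OF this] have mid: "4 * d n \<le> (norm (w n + w m))\<^sup>2"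
      by (simp add: power_mult_distrib power2_norm_eq_inner algebra_simps inner_commute)
    have par: "(norm (w n - w m))\<^sup>2 = 2 * (norm (w n))\<^sup>2 + 2 * (norm (w m))\<^sup>2 - (norm (w n + w m))\<^sup>2"
      by (simp add: power2_norm_eq_inner algebra_simps inner_commute)
    have "1 / real (Suc m) \<le> 1 / real (Suc n)"
      using that by (simp add: frac_le)
    with mid par w(2)[of n] w(2)[of m] L(2)[of m] show ?thesis
      unfolding dist_norm e_def by argo
  qed
  have "Cauchy w"
  proof (rule metric_CauchyI)
    fix r :: real assume r: "0 < r"
    then have "\<forall>\<^sub>F n in sequentially. e n < (r/2)\<^sup>2"
      using e0 by (auto intro: order_tendstoD)
    then obtain N where N: "e N < (r/2)\<^sup>2" by (auto simp: eventually_sequentially)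
    have near: "dist (w N) (w m) < r / 2" if "N \<le> m" for m
      by (rule power2_less_imp_less[OF le_less_trans[OF dist_e[OF that] N]]) (use r in simp)
    have "dist (w m) (w n) < r" if "N \<le> m" "N \<le> n" for m n
      using dist_triangle3[of "w m" "w n" "w N"] near[OF that(1)] near[OF that(2)]
      by linarith
    then show "\<exists>N. \<forall>m\<ge>N. \<forall>n\<ge>N. dist (w m) (w n) < r" by blast
  qed
  then obtain l where l: "w \<longlonglongrightarrow> l" using Cauchy_convergent convergent_def by blast
  have "l \<in> K n" for n
  proof (rule Lim_in_closed_set[OF closed])
    show "\<forall>\<^sub>F m in sequentially. w m \<in> K n"
      unfolding eventually_sequentially using w(1) sub by blast
  qed (use l in auto)
  then show ?thesis by blast
qed

text \<open>
  Adding one monotonically related pair to the graph keeps it monotone, so maximality forces the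
  pair to be there already.
\<close>

lemma maximally_monotone_op_memI:
  assumes "maximally_monotone_op A" and rel: "\<And>y v. v \<in> A y \<Longrightarrow> 0 \<le> (x - y) \<bullet> (u - v)"
  shows "u \<in> A x"
proof -
  define B where "B = A(x := insert u (A x))"
  have mono: "monotone_op A" and max: "\<And>B. monotone_op B \<Longrightarrow> (\<And>x. A x \<subseteq> B x) \<Longrightarrow> B = A"
    using assms(1) unfolding maximally_monotone_op_def by auto
  have rel': "0 \<le> (y - x) \<bullet> (v - u)" if "v \<in> A y" for y v
    using rel[OF that] by (simp add: algebra_simps inner_diff_left inner_diff_right)
  have "monotone_op B"
    using mono rel rel' unfolding monotone_op_def B_def by (auto split: if_splits)
  then have "B = A" by (rule max) (auto simp: B_def)
  then show ?thesis by (metis B_def fun_upd_same insertI1)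
qed

lemma norm_add_scaleR_power2:
  fixes p d :: "'a::real_inner"
  shows "(norm (p + \<theta> *\<^sub>R d))\<^sup>2 = (norm p)\<^sup>2 + 2 * \<theta> * (p \<bullet> d) + \<theta>\<^sup>2 * (norm d)\<^sup>2"
  unfolding power2_norm_eq_inner by (simp add: inner_commute algebra_simps power2_eq_square)

text \<open>
  Minty's theorem in the form that \<open>I + A\<close> has a zero. Let \<open>F\<close> be the Fitzpatrick function
  \<open>F (x, u) = sup {\<langle>x, v\<rangle> + \<langle>y, u\<rangle> - \<langle>y, v\<rangle> | v \<in> A y}\<close>. Maximality gives \<open>F (x, u) \<ge> \<langle>x, u\<rangle>\<close>, and
  monotonicity gives \<open>F (y, v) \<le> \<langle>y, v\<rangle>\<close> on the graph. The set \<open>K s\<close> below is the sublevel set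
  \<open>{p. F p + |p|\<^sup>2/2 \<le> s}\<close>; after completing the square it is an intersection of balls, so a
  minimiser \<open>(x, u)\<close> exists by the nested set lemma. Its first order condition against graph
  points \<open>(y, v)\<close> reads \<open>|x + u|\<^sup>2 \<le> \<langle>- u - y, - x - v\<rangle>\<close>. Therefore \<open>(- u, - x)\<close> is in the graph,
  and inserting this very point gives \<open>u = - x\<close>. Monotonicity and maximality are phrased on the
  graph, so that the lemma applies directly to rescaled and translated operators.
\<close>

lemma Minty_zero:
  fixes A :: "'a::{real_inner,complete_space} \<Rightarrow> 'a set"
  assumes mono: "\<And>x y u v. u \<in> A x \<Longrightarrow> v \<in> A y \<Longrightarrow> 0 \<le> (x - y) \<bullet> (u - v)"
    and max: "\<And>x u. (\<And>y v. v \<in> A y \<Longrightarrow> 0 \<le> (x - y) \<bullet> (u - v)) \<Longrightarrow> u \<in> A x"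
  shows "\<exists>x. - x \<in> A x"
proof -
  define K where "K s = {p::'a \<times> 'a. \<forall>y. \<forall>v\<in>A y.
      p \<bullet> (v, y) - y \<bullet> v + (norm p)\<^sup>2 / 2 \<le> s}" for s
  obtain y\<^sub>0 v\<^sub>0 where g\<^sub>0: "v\<^sub>0 \<in> A y\<^sub>0" using max by blast
  have K_bound: "x \<bullet> u + (norm (x, u))\<^sup>2 / 2 \<le> s" if "(x, u) \<in> K s" for x u s
  proof (rule ccontr)
    assume neg: "\<not> ?thesis"
    have less: "0 < (x - y) \<bullet> (u - v)" if "v \<in> A y" for y v
    proof -
      have "(x, u) \<bullet> (v, y) - y \<bullet> v + (norm (x, u))\<^sup>2 / 2 \<le> s"
        using \<open>(x, u) \<in> K s\<close> that by (auto simp: K_def)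
      with neg show ?thesis by (simp add: inner_diff_left inner_diff_right inner_commute)
    qed
    then have "u \<in> A x" by (intro max) (simp add: less less_imp_le)
    from less[OF this] show False by simp
  qed
  have K_nonneg: "0 \<le> s" if "p \<in> K s" for p s
  proof -
    obtain x u where p: "p = (x, u)" by (cases p)
    have "x \<bullet> u + (norm (x, u))\<^sup>2 / 2 = (norm (x + u))\<^sup>2 / 2"
      by (simp add: power2_norm_eq_inner inner_add_left inner_add_right inner_commute field_simps)
    with K_bound[of x u s] that p show ?thesis
      by (smt (verit) divide_nonneg_pos zero_le_power2)
  qed
  have K_graph: "(y, v) \<in> K (y \<bullet> v + (norm (y, v))\<^sup>2 / 2)" if "v \<in> A y" for y v
  proof -
    have "(y, v) \<bullet> (v', y') - y' \<bullet> v' \<le> y \<bullet> v" if "v' \<in> A y'" for y' v'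
      using mono[OF \<open>v \<in> A y\<close> that] by (simp add: inner_diff_left inner_diff_right inner_commute)
    then show ?thesis by (auto simp: K_def)
  qed
  define m where "m = Inf {s. K s \<noteq> {}}"
  have bdd: "bdd_below {s. K s \<noteq> {}}" using K_nonneg by (intro bdd_belowI[of _ 0]) auto
  have ne: "{s. K s \<noteq> {}} \<noteq> {}" using K_graph[OF g\<^sub>0] by auto
  have m_le: "m \<le> s" if "p \<in> K s" for p s
    unfolding m_def using that by (intro cInf_lower bdd) auto
  have K_mono: "K s \<subseteq> K t" if "s \<le> t" for s t using that by (force simp: K_def)
  have "(\<Inter>n. K (m + 1 / real (Suc n))) \<noteq> {}"
  proof (rule nested_closed_convex_Inter_nonempty)
    fix n
    have K_ball: "K s = (\<Inter>y. \<Inter>v\<in>A y.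
        {p. (norm (p + (v, y)))\<^sup>2 \<le> 2 * s + 2 * (y \<bullet> v) + (norm (v, y))\<^sup>2})" for s
    proof -
      have "p \<bullet> g - c + (norm p)\<^sup>2 / 2 \<le> s \<longleftrightarrow> (norm (p + g))\<^sup>2 \<le> 2 * s + 2 * c + (norm g)\<^sup>2"
        for p g :: "'a \<times> 'a" and c
        by (simp add: power2_norm_eq_inner inner_add_left inner_add_right inner_commute field_simps)
      then show ?thesis unfolding K_def by auto
    qed
    have sub: "{p. (norm (p + g))\<^sup>2 \<le> c} = (if 0 \<le> c then cball (- g) (sqrt c) else {})"
      for g :: "'a \<times> 'a" and c
    proof (cases "0 \<le> c")
      case True
      have "(norm (p + g))\<^sup>2 \<le> c \<longleftrightarrow> norm (p + g) \<le> sqrt c" for p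
        using real_sqrt_le_iff[of "(norm (p + g))\<^sup>2" c] by simp
      moreover have "dist (- g) p = norm (p + g)" for p
        unfolding dist_norm by (metis add.commute norm_minus_cancel minus_add_distrib
            diff_conv_add_uminus)
      ultimately show ?thesis using True by auto
    next
      case False
      then show ?thesis by (auto intro: order_trans[OF zero_le_power2])
    qed
    show "closed (K (m + 1 / real (Suc n)))"
      unfolding K_ball sub by (intro closed_INT ballI) auto
    show "convex (K (m + 1 / real (Suc n)))"
      unfolding K_ball sub by (intro convex_INT) auto
    show "bounded (K (m + 1 / real (Suc 0)))"
      by (rule bounded_subset[of "{p. (norm (p + (v\<^sub>0, y\<^sub>0)))\<^sup>2 \<le>
             2 * (m + 1 / real (Suc 0)) + 2 * (y\<^sub>0 \<bullet> v\<^sub>0) + (norm (v\<^sub>0, y\<^sub>0))\<^sup>2}"])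
        (use g\<^sub>0 in \<open>auto simp: sub K_ball simp del: norm_Pair\<close>)
    have "m < m + 1 / real (Suc n)" by simp
    then obtain s where "K s \<noteq> {}" "s < m + 1 / real (Suc n)"
      unfolding m_def by (subst (asm) cInf_less_iff[OF ne bdd]) auto
    then show "K (m + 1 / real (Suc n)) \<noteq> {}" using K_mono[of s "m + 1 / real (Suc n)"] by auto
  next
    show "decseq (\<lambda>n. K (m + 1 / real (Suc n)))"
      unfolding decseq_def by (intro allI impI K_mono) (simp add: frac_le)
  qed
  then obtain p where p: "\<And>n. p \<in> K (m + 1 / real (Suc n))" by auto
  have p_in: "p \<in> K m"
    unfolding K_def
  proof (intro CollectI allI ballI)
    fix y v assume v: "v \<in> A y"
    have "p \<bullet> (v, y) - y \<bullet> v + (norm p)\<^sup>2 / 2 \<le> m + 1 / real (Suc n)" for n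
      using p[of n] v by (auto simp: K_def)
    moreover have "(\<lambda>n. m + 1 / real (Suc n)) \<longlonglongrightarrow> m + 0"
      by (intro tendsto_add tendsto_const LIMSEQ_Suc[OF lim_1_over_n])
    ultimately show "p \<bullet> (v, y) - y \<bullet> v + (norm p)\<^sup>2 / 2 \<le> m"
      by (intro LIMSEQ_le_const) auto
  qed
  obtain x u where pxu: "p = (x, u)" by (cases p)
  have var: "m + (norm p)\<^sup>2 / 2 \<le> y \<bullet> v + p \<bullet> (y, v)" if v: "v \<in> A y" for y v
  proof -
    define g where "g = (y, v)"
    define P q r c where "P = (norm p)\<^sup>2" and "q = p \<bullet> (g - p)"
      and "r = (norm (g - p))\<^sup>2" and "c = y \<bullet> v"
    note defs = this
    define D where "D = c - m + P / 2 + q"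
    \<comment> \<open>\<open>D\<close> is the directional derivative at the minimiser \<open>p\<close> towards the graph point \<open>g\<close>, with the value
      of the Fitzpatrick function at \<open>g\<close> replaced by its upper bound \<open>c\<close>.\<close>
    have step: "0 \<le> D + \<theta> * r / 2" if \<theta>: "0 < \<theta>" "\<theta> < 1" for \<theta>
    proof -
      have "p + \<theta> *\<^sub>R (g - p) \<in> K ((1 - \<theta>) * (m - (norm p)\<^sup>2 / 2) + \<theta> * (y \<bullet> v)
              + (norm (p + \<theta> *\<^sub>R (g - p)))\<^sup>2 / 2)"
        unfolding K_def
      proof (intro CollectI allI ballI)
        fix y' v' assume v': "v' \<in> A y'"
        have 1: "p \<bullet> (v', y') - y' \<bullet> v' \<le> m - (norm p)\<^sup>2 / 2"
          using p_in v' by (auto simp: K_def algebra_simps)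
        have 2: "g \<bullet> (v', y') - y' \<bullet> v' \<le> y \<bullet> v"
          using K_graph[OF v] v' by (auto simp: K_def g_def)
        have "(1 - \<theta>) * (p \<bullet> (v', y') - y' \<bullet> v') + \<theta> * (g \<bullet> (v', y') - y' \<bullet> v')
           \<le> (1 - \<theta>) * (m - (norm p)\<^sup>2 / 2) + \<theta> * (y \<bullet> v)"
          using \<theta> 1 2 by (intro add_mono mult_left_mono) auto
        then show "(p + \<theta> *\<^sub>R (g - p)) \<bullet> (v', y') - y' \<bullet> v' + (norm (p + \<theta> *\<^sub>R (g - p)))\<^sup>2 / 2
            \<le> (1 - \<theta>) * (m - (norm p)\<^sup>2 / 2) + \<theta> * (y \<bullet> v) + (norm (p + \<theta> *\<^sub>R (g - p)))\<^sup>2 / 2"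
          by (simp add: inner_add_left inner_diff_left algebra_simps del: inner_Pair)
      qed
      from m_le[OF this] have "m \<le> (1 - \<theta>) * (m - P / 2) + \<theta> * c + (P + 2 * \<theta> * q + \<theta>\<^sup>2 * r) / 2"
        unfolding norm_add_scaleR_power2 defs .
      then have "0 \<le> \<theta> * (D + \<theta> * r / 2)"
        unfolding D_def by (simp add: field_simps power2_eq_square)
      then show ?thesis using \<theta> by (simp add: zero_le_mult_iff)
    qed
    have "0 \<le> D"
    proof (rule tendsto_lowerbound)
      show "((\<lambda>\<theta>. D + \<theta> * r / 2) \<longlongrightarrow> D) (at_right 0)"
        by (auto intro!: tendsto_eq_intros)
      show "\<forall>\<^sub>F \<theta> in at_right 0. 0 \<le> D + \<theta> * r / 2"
        using step by (auto intro!: eventually_at_rightI[of 0 1])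
    qed auto
    then show ?thesis
      by (simp add: D_def defs g_def inner_diff_right power2_norm_eq_inner del: inner_Pair)
  qed
  have m_ge: "x \<bullet> u + (norm p)\<^sup>2 / 2 \<le> m"
    using K_bound p_in pxu by blast
  have sq: "(norm (x + u))\<^sup>2 \<le> (- u - y) \<bullet> (- x - v)" if "v \<in> A y" for y v
  proof -
    have "(- u - y) \<bullet> (- x - v) = x \<bullet> u + y \<bullet> v + p \<bullet> (y, v)"
      by (simp add: pxu inner_diff_left inner_diff_right inner_commute)
    moreover have "(norm (x + u))\<^sup>2 = 2 * (x \<bullet> u) + (norm p)\<^sup>2"
      by (simp add: pxu power2_norm_eq_inner inner_add_left inner_add_right inner_commute)
    ultimately show ?thesis using var[OF that] m_ge by linarith
  qed
  have "- x \<in> A (- u)" by (rule max) (use sq in \<open>blast intro: order_trans[OF zero_le_power2]\<close>)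
  with sq[OF this] have "u = - x" by (simp add: eq_neg_iff_add_eq_0 add.commute)
  with \<open>- x \<in> A (- u)\<close> show ?thesis by auto
qed

section \<open>The Yosida regularization\<close>

text \<open>
  Minty's theorem for the operator \<open>y \<mapsto> \<mu> A y - x\<close> supplies a value of the resolvent, and
  monotonicity makes it unique, which is what the definite description in \<open>resolvent\<close> needs.
\<close>

lemma yosida_mem:
  fixes A :: "'a::{real_inner,complete_space} \<Rightarrow> 'a set"
  assumes A: "maximally_monotone_op A" and \<mu>: "0 < \<mu>"
  shows "yosida A \<mu> x \<in> A (x - \<mu> *\<^sub>R yosida A \<mu> x)"
proof -
  define B where "B y = (\<lambda>u. \<mu> *\<^sub>R u - x) ` A y" for y
  have mono: "0 \<le> (y - y') \<bullet> (u - u')" if "u \<in> A y" "u' \<in> A y'" for y y' u u'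
    using A that unfolding maximally_monotone_op_def monotone_op_def by blast
  have "\<exists>z. - z \<in> B z"
  proof (rule Minty_zero)
    fix y y' u u' assume "u \<in> B y" "u' \<in> B y'"
    then obtain w w' where w: "w \<in> A y" "w' \<in> A y'" "u = \<mu> *\<^sub>R w - x" "u' = \<mu> *\<^sub>R w' - x"
      by (auto simp: B_def)
    then have "u - u' = \<mu> *\<^sub>R (w - w')" by (simp add: scaleR_diff_right)
    then have "(y - y') \<bullet> (u - u') = \<mu> * ((y - y') \<bullet> (w - w'))" by simp
    then show "0 \<le> (y - y') \<bullet> (u - u')" using mono[OF w(1,2)] \<mu> by simp
  next
    fix y u assume *: "\<And>y' v. v \<in> B y' \<Longrightarrow> 0 \<le> (y - y') \<bullet> (u - v)"
    have "(1 / \<mu>) *\<^sub>R (u + x) \<in> A y"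
    proof (rule maximally_monotone_op_memI[OF A])
      fix y' w assume "w \<in> A y'"
      then have "0 \<le> (y - y') \<bullet> (u - (\<mu> *\<^sub>R w - x))" by (intro *) (auto simp: B_def)
      also have "u - (\<mu> *\<^sub>R w - x) = \<mu> *\<^sub>R ((1 / \<mu>) *\<^sub>R (u + x) - w)"
        using \<mu> by (simp add: algebra_simps)
      finally show "0 \<le> (y - y') \<bullet> ((1 / \<mu>) *\<^sub>R (u + x) - w)"
        using \<mu> by (simp add: zero_le_mult_iff)
    qed
    then show "u \<in> B y" unfolding B_def using \<mu>
      by (intro image_eqI[of _ _ "(1 / \<mu>) *\<^sub>R (u + x)"]) auto
  qed
  then obtain z u where u: "u \<in> A z" "- z = \<mu> *\<^sub>R u - x" by (auto simp: B_def)
  then have x: "x = z + \<mu> *\<^sub>R u"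
    by (metis add.inverse_inverse minus_diff_eq eq_diff_eq diff_minus_eq_add
        uminus_add_conv_diff add.commute)
  have "resolvent A \<mu> x = z"
    unfolding resolvent_def op_inverse_def
  proof (rule the_equality)
    show "z \<in> {xa. x \<in> {xa + \<mu> *\<^sub>R u |u. u \<in> A xa}}" using x u by auto
  next
    fix z' assume "z' \<in> {xa. x \<in> {xa + \<mu> *\<^sub>R u |u. u \<in> A xa}}"
    then obtain u' where u': "u' \<in> A z'" "x = z' + \<mu> *\<^sub>R u'" by auto
    with x have "z - z' = \<mu> *\<^sub>R (u' - u)" by (simp add: algebra_simps)
    then have "(z - z') \<bullet> (u - u') = \<mu> * ((u' - u) \<bullet> (u - u'))" by simp
    also have "\<dots> = - (\<mu> * (norm (u - u'))\<^sup>2)"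
      by (simp add: power2_norm_eq_inner algebra_simps inner_commute)
    finally have "(z - z') \<bullet> (u - u') = - (\<mu> * (norm (u - u'))\<^sup>2)" .
    with mono[OF u(1) u'(1)] \<mu> have "u = u'" by (simp add: mult_le_0_iff)
    with x u' show "z' = z" by simp
  qed
  then have "yosida A \<mu> x = u" using x \<mu> by (simp add: yosida_def)
  with u x show ?thesis by simp
qed

text \<open>
  This is monotonicity of \<open>A\<close> between \<open>(z, 0)\<close> and the graph point from \<open>yosida_mem\<close>.
\<close>

lemma yosida_cocoercive_at_zero:
  fixes A :: "'a::{real_inner,complete_space} \<Rightarrow> 'a set"
  assumes A: "maximally_monotone_op A" and \<mu>: "0 < \<mu>" and z: "z \<in> op_inverse A 0"
  shows "\<mu> * (norm (yosida A \<mu> x))\<^sup>2 \<le> (x - z) \<bullet> yosida A \<mu> x"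
proof -
  have "0 \<le> (x - \<mu> *\<^sub>R yosida A \<mu> x - z) \<bullet> (yosida A \<mu> x - 0)"
    using A z yosida_mem[OF A \<mu>, of x]
    unfolding maximally_monotone_op_def monotone_op_def op_inverse_def by blast
  then show ?thesis by (simp add: power2_norm_eq_inner algebra_simps)
qed

text \<open>
  The displacement \<open>\<mu> A\<^sub>\<mu>\<close> is nonexpansive for fixed \<open>\<mu>\<close>; here the index changes as well.
  Multiplying the monotonicity inequality by \<open>\<nu>\<close> gives \<open>0 \<le> \<langle>p, q\<rangle>\<close>, where \<open>p + q\<close> differs from
  \<open>x - y\<close>, and \<open>q\<close> from the difference of the displacements, only by the error \<open>e\<close> that the change
  of index causes.
\<close>

lemma yosida_displacement_dist:
  fixes A :: "'a::{real_inner,complete_space} \<Rightarrow> 'a set"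
  assumes A: "maximally_monotone_op A" and \<mu>: "0 < \<mu>" "0 < \<nu>"
  shows "norm (\<mu> *\<^sub>R yosida A \<mu> x - \<nu> *\<^sub>R yosida A \<nu> y)
     \<le> norm (x - y) + 2 * \<bar>\<nu> / \<mu> - 1\<bar> * norm (\<mu> *\<^sub>R yosida A \<mu> x)"
proof -
  define \<xi> \<eta> where "\<xi> = \<mu> *\<^sub>R yosida A \<mu> x" and "\<eta> = \<nu> *\<^sub>R yosida A \<nu> y"
  define e where "e = (\<nu> / \<mu> - 1) *\<^sub>R \<xi>"
  define p q where "p = (x - \<xi>) - (y - \<eta>)" and "q = \<xi> - \<eta> + e"
  have "0 \<le> p \<bullet> (yosida A \<mu> x - yosida A \<nu> y)"
    using A yosida_mem[OF A \<mu>(1), of x] yosida_mem[OF A \<mu>(2), of y]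
    unfolding maximally_monotone_op_def monotone_op_def p_def \<xi>_def \<eta>_def by blast
  moreover have "q = \<nu> *\<^sub>R (yosida A \<mu> x - yosida A \<nu> y)"
    unfolding q_def e_def \<xi>_def \<eta>_def using \<mu> by (simp add: algebra_simps)
  ultimately have "0 \<le> p \<bullet> q" using \<mu> by simp
  then have "(norm q)\<^sup>2 \<le> (norm (p + q))\<^sup>2"
    by (simp add: power2_norm_eq_inner algebra_simps inner_commute)
  then have "norm q \<le> norm (p + q)" by (rule power2_le_imp_le) simp
  also have "p + q = (x - y) + e" by (simp add: p_def q_def)
  finally have "norm q \<le> norm (x - y) + norm e" using norm_triangle_ineq order_trans by blast
  moreover have "norm (\<xi> - \<eta>) \<le> norm q + norm e"
    using norm_triangle_ineq4[of q e] by (simp add: q_def)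
  moreover have "norm e = \<bar>\<nu> / \<mu> - 1\<bar> * norm \<xi>" by (simp add: e_def)
  ultimately show ?thesis by (simp add: \<xi>_def \<eta>_def)
qed

section \<open>Opial's lemma\<close>

text \<open>
  A point \<open>w\<close> with the second property belongs to every closed half-space that contains a tail of
  \<open>x\<close>, that is, to the closed convex hull of every tail. Such a point can be found inside any
  closed half-space that the trajectory visits at arbitrarily large times, because the
  intersections of that half-space with these hulls form a decreasing sequence of bounded closed
  convex sets.
\<close>

lemma exists_weak_hull_point:
  fixes x :: "real \<Rightarrow> 'a::{real_inner,complete_space}"
  assumes bound: "\<forall>\<^sub>F t in at_top. norm (x t) \<le> B" and freq: "\<exists>\<^sub>F t in at_top. c \<le> x t \<bullet> y"
  obtains w where "c \<le> w \<bullet> y" "\<And>y c. \<forall>\<^sub>F t in at_top. x t \<bullet> y \<le> c \<Longrightarrow> w \<bullet> y \<le> c"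
proof -
  obtain T where T: "\<And>t. T \<le> t \<Longrightarrow> norm (x t) \<le> B"
    using bound by (auto simp: eventually_at_top_linorder)
  define H where "H n = {(y', c'). \<forall>t\<ge>T + real n. x t \<bullet> y' \<le> c'}" for n :: nat
  define K where "K n = {w. c \<le> w \<bullet> y} \<inter> (\<Inter>(y', c')\<in>H n. {w. w \<bullet> y' \<le> c'})" for n
  have "(\<Inter>n. K n) \<noteq> {}"
  proof (rule nested_closed_convex_Inter_nonempty)
    fix n
    have half: "{w. w \<bullet> y' \<le> c'} = {w. y' \<bullet> w \<le> c'}" "{w. c' \<le> w \<bullet> y'} = {w. y' \<bullet> w \<ge> c'}"
      for y' :: 'a and c' by (auto simp: inner_commute)
    show "closed (K n)" unfolding K_def half
      by (intro closed_Int closed_INT closed_halfspace_ge ballI)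
        (auto intro: closed_halfspace_le)
    show "convex (K n)" unfolding K_def half
      by (intro convex_Int convex_INT convex_halfspace_ge) (auto intro: convex_halfspace_le)
    obtain t where "T + real n \<le> t" "c \<le> x t \<bullet> y"
      using freq by (auto simp: frequently_def eventually_at_top_linorder)
    then have "x t \<in> K n" by (auto simp: K_def H_def)
    then show "K n \<noteq> {}" by auto
  next
    have "H m \<subseteq> H n" if "m \<le> n" for m n using that by (auto simp: H_def)
    then show "decseq K" unfolding decseq_def K_def by blast
    have "norm w \<le> B" if w: "w \<in> K 0" for w
    proof -
      have "x t \<bullet> w \<le> B * norm w" if "T \<le> t" for t
        using norm_cauchy_schwarz[of "x t" w] mult_right_mono[OF T[OF that] norm_ge_zero[of w]]
        by linarith
      then have "(w, B * norm w) \<in> H 0" by (simp add: H_def)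
      then have "norm w * norm w \<le> B * norm w"
        using w by (auto simp: K_def simp flip: power2_norm_eq_inner power2_eq_square)
      moreover have "0 \<le> B" using T[of T] norm_ge_zero order_trans by blast
      ultimately show ?thesis by (cases "w = 0") auto
    qed
    then show "bounded (K 0)" by (auto simp: bounded_iff)
  qed
  then obtain w where w: "\<And>n. w \<in> K n" by auto
  have "w \<bullet> y' \<le> c'" if ev: "\<forall>\<^sub>F t in at_top. x t \<bullet> y' \<le> c'" for y' c'
  proof -
    obtain N where N: "\<And>t. N \<le> t \<Longrightarrow> x t \<bullet> y' \<le> c'"
      using ev unfolding eventually_at_top_linorder by blast
    obtain n :: nat where "N - T \<le> real n" using real_arch_simple by blast
    then have "(y', c') \<in> H n" using N by (auto simp: H_def)
    then show ?thesis using w[of n] by (auto simp: K_def)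
  qed
  moreover have "c \<le> w \<bullet> y" using w[of 0] by (auto simp: K_def)
  ultimately show thesis using that by blast
qed

text \<open>
  Existence of the limits of \<open>|x - w|\<^sup>2\<close> and \<open>|x - w'|\<^sup>2\<close> makes \<open>\<langle>x, w - w'\<rangle>\<close> convergent, and both
  hull points \<open>w\<close> and \<open>w'\<close> must give \<open>w - w'\<close> the same value as this limit; so there is only one
  hull point \<open>z\<close>. If \<open>\<langle>x, y\<rangle>\<close> exceeded \<open>\<langle>z, y\<rangle>\<close> by a fixed amount at arbitrarily large times,
  \<open>exists_weak_hull_point\<close> would produce a second one.
\<close>

lemma Opial_weak_convergence:
  fixes x :: "real \<Rightarrow> 'a::{real_inner,complete_space}"
  assumes bound: "\<forall>\<^sub>F t in at_top. norm (x t) \<le> B"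
    and lim: "\<And>z. z \<in> S \<Longrightarrow> \<exists>l. ((\<lambda>t. (norm (x t - z))\<^sup>2) \<longlongrightarrow> l) at_top"
    and hull: "\<And>w. (\<And>y c. \<forall>\<^sub>F t in at_top. x t \<bullet> y \<le> c \<Longrightarrow> w \<bullet> y \<le> c) \<Longrightarrow> w \<in> S"
  shows "\<exists>z\<in>S. weakly_tendsto x z at_top"
proof -
  define C where "C = {w. \<forall>y c. (\<forall>\<^sub>F t in at_top. x t \<bullet> y \<le> c) \<longrightarrow> w \<bullet> y \<le> c}"
  have C_S: "w \<in> S" if "w \<in> C" for w
    by (rule hull) (use that in \<open>auto simp: C_def\<close>)
  have C_lim: "w \<bullet> d = L" if w: "w \<in> C" and L: "((\<lambda>t. x t \<bullet> d) \<longlongrightarrow> L) at_top" for w d L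
  proof -
    have le: "w \<bullet> d \<le> L" if L: "((\<lambda>t. x t \<bullet> d) \<longlongrightarrow> L) at_top" for d L
    proof (rule field_le_epsilon)
      fix e :: real assume "0 < e"
      then have "\<forall>\<^sub>F t in at_top. x t \<bullet> d < L + e" using L by (auto intro: order_tendstoD)
      then have "\<forall>\<^sub>F t in at_top. x t \<bullet> d \<le> L + e" by eventually_elim simp
      then show "w \<bullet> d \<le> L + e" using w by (auto simp: C_def)
    qed
    have "((\<lambda>t. x t \<bullet> - d) \<longlongrightarrow> - L) at_top" using tendsto_minus[OF L] by simp
    from le[OF this] le[OF L] show ?thesis by simp
  qed
  have unique: "w = w'" if w: "w \<in> C" "w' \<in> C" for w w'
  proof -
    obtain l where l: "((\<lambda>t. (norm (x t - w))\<^sup>2) \<longlongrightarrow> l) at_top"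
      using lim[OF C_S[OF w(1)]] by blast
    obtain l' where l': "((\<lambda>t. (norm (x t - w'))\<^sup>2) \<longlongrightarrow> l') at_top"
      using lim[OF C_S[OF w(2)]] by blast
    have "x t \<bullet> (w - w')
        = ((norm (x t - w'))\<^sup>2 - (norm (x t - w))\<^sup>2 + (norm w)\<^sup>2 - (norm w')\<^sup>2) / 2" for t
      by (simp add: power2_norm_eq_inner algebra_simps inner_commute)
    then have "((\<lambda>t. x t \<bullet> (w - w')) \<longlongrightarrow> (l' - l + (norm w)\<^sup>2 - (norm w')\<^sup>2) / 2) at_top"
      by (simp only:) (intro tendsto_intros l l', simp)
    from C_lim[OF w(1) this] C_lim[OF w(2) this] have "(w - w') \<bullet> (w - w') = 0"
      by (simp add: inner_diff_left)
    then show ?thesis by simp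
  qed
  have exists: "\<exists>w\<in>C. c \<le> w \<bullet> y" if "\<exists>\<^sub>F t in at_top. c \<le> x t \<bullet> y" for c y
    by (rule exists_weak_hull_point[OF bound that]) (auto simp: C_def)
  \<comment> \<open>The half-space for the direction \<open>0\<close> is the whole space, so this only asks for some point of \<open>C\<close>.\<close>
  obtain z where z: "z \<in> C" using exists[of 0 0] by auto
  have upper: "\<forall>\<^sub>F t in at_top. x t \<bullet> y < z \<bullet> y + e" if "0 < e" for y e
  proof (rule ccontr)
    assume "\<not> ?thesis"
    then have "\<exists>\<^sub>F t in at_top. z \<bullet> y + e \<le> x t \<bullet> y" by (simp add: frequently_def not_le)
    from exists[OF this] unique[OF z] that show False by fastforce
  qed
  have "((\<lambda>t. x t \<bullet> y) \<longlongrightarrow> z \<bullet> y) at_top" for y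
  proof (rule tendstoI)
    fix e :: real assume "0 < e"
    from upper[OF this, of y] upper[OF this, of "- y"]
    show "\<forall>\<^sub>F t in at_top. dist (x t \<bullet> y) (z \<bullet> y) < e"
      by eventually_elim (auto simp: dist_real_def)
  qed
  with C_S[OF z] show ?thesis by (auto simp: weakly_tendsto_def)
qed

section \<open>Absolutely continuous functions and differential inequalities\<close>

lemma absolutely_continuous_on_IccD:
  assumes "absolutely_continuous_on_Icc a b v" "0 < e"
  shows "\<exists>\<delta>>0. \<forall>(n::nat) l r. (\<forall>k<n. a \<le> l k \<and> l k \<le> r k \<and> r k \<le> b) \<longrightarrow>
        disjoint_family_on (\<lambda>k. {l k<..<r k}) {..<n} \<longrightarrow> (\<Sum>k<n. r k - l k) < \<delta> \<longrightarrow>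
        (\<Sum>k<n. norm (v (r k) - v (l k))) < e"
  using assms unfolding absolutely_continuous_on_Icc_def by meson

text \<open>
  The closure properties below are all instances of this comparison of increments.
\<close>

lemma absolutely_continuous_on_Icc_dominated:
  fixes p :: "real \<Rightarrow> 'a::real_normed_vector" and q :: "real \<Rightarrow> 'b::real_normed_vector"
    and \<phi> :: "real \<Rightarrow> 'c::real_normed_vector"
  assumes p: "absolutely_continuous_on_Icc a b p" and q: "absolutely_continuous_on_Icc a b q"
    and dom: "\<And>l r. a \<le> l \<Longrightarrow> l \<le> r \<Longrightarrow> r \<le> b \<Longrightarrow>
               norm (\<phi> r - \<phi> l) \<le> M * (norm (p r - p l) + norm (q r - q l))"
  shows "absolutely_continuous_on_Icc a b \<phi>"
  unfolding absolutely_continuous_on_Icc_def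
proof (intro allI impI)
  fix e :: real assume e: "0 < e"
  define M' where "M' = \<bar>M\<bar> + 1"
  have M': "0 < M'" "M \<le> M'" by (auto simp: M'_def)
  have e': "0 < e / (2 * M')" using e M' by simp
  obtain \<delta>\<^sub>1 where \<delta>\<^sub>1: "0 < \<delta>\<^sub>1" and p_small: "\<forall>(n::nat) l r. (\<forall>k<n. a \<le> l k \<and> l k \<le> r k \<and> r k \<le> b) \<longrightarrow>
        disjoint_family_on (\<lambda>k. {l k<..<r k}) {..<n} \<longrightarrow> (\<Sum>k<n. r k - l k) < \<delta>\<^sub>1 \<longrightarrow>
        (\<Sum>k<n. norm (p (r k) - p (l k))) < e / (2 * M')"
    using absolutely_continuous_on_IccD[OF p e'] by (elim exE conjE) (rule that)
  obtain \<delta>\<^sub>2 where \<delta>\<^sub>2: "0 < \<delta>\<^sub>2" and q_small: "\<forall>(n::nat) l r. (\<forall>k<n. a \<le> l k \<and> l k \<le> r k \<and> r k \<le> b) \<longrightarrow>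
        disjoint_family_on (\<lambda>k. {l k<..<r k}) {..<n} \<longrightarrow> (\<Sum>k<n. r k - l k) < \<delta>\<^sub>2 \<longrightarrow>
        (\<Sum>k<n. norm (q (r k) - q (l k))) < e / (2 * M')"
    using absolutely_continuous_on_IccD[OF q e'] by (elim exE conjE) (rule that)
  show "\<exists>\<delta>>0. \<forall>(n::nat) l r. (\<forall>k<n. a \<le> l k \<and> l k \<le> r k \<and> r k \<le> b) \<and>
      disjoint_family_on (\<lambda>k. {l k<..<r k}) {..<n} \<and> (\<Sum>k<n. r k - l k) < \<delta> \<longrightarrow>
      (\<Sum>k<n. norm (\<phi> (r k) - \<phi> (l k))) < e"
  proof (intro exI[of _ "min \<delta>\<^sub>1 \<delta>\<^sub>2"] conjI allI impI; (elim conjE)?)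
    show "0 < min \<delta>\<^sub>1 \<delta>\<^sub>2" using \<delta>\<^sub>1 \<delta>\<^sub>2 by simp
  next
    fix n :: nat and l r :: "nat \<Rightarrow> real"
    assume lr: "\<forall>k<n. a \<le> l k \<and> l k \<le> r k \<and> r k \<le> b"
      and disj: "disjoint_family_on (\<lambda>k. {l k<..<r k}) {..<n}"
      and small: "(\<Sum>k<n. r k - l k) < min \<delta>\<^sub>1 \<delta>\<^sub>2"
    have "(\<Sum>k<n. norm (\<phi> (r k) - \<phi> (l k)))
        \<le> (\<Sum>k<n. M' * (norm (p (r k) - p (l k)) + norm (q (r k) - q (l k))))"
    proof (rule sum_mono)
      fix k assume "k \<in> {..<n}"
      with lr have k: "a \<le> l k" "l k \<le> r k" "r k \<le> b" by auto
      have "M * (norm (p (r k) - p (l k)) + norm (q (r k) - q (l k)))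
          \<le> M' * (norm (p (r k) - p (l k)) + norm (q (r k) - q (l k)))"
        using M' by (intro mult_right_mono) auto
      with dom[OF k] show "norm (\<phi> (r k) - \<phi> (l k))
          \<le> M' * (norm (p (r k) - p (l k)) + norm (q (r k) - q (l k)))"
        by linarith
    qed
    also have "\<dots> = M' * ((\<Sum>k<n. norm (p (r k) - p (l k))) + (\<Sum>k<n. norm (q (r k) - q (l k))))"
      by (simp add: sum_distrib_left sum.distrib distrib_left)
    also have "\<dots> < M' * (e / (2 * M') + e / (2 * M'))"
      using p_small[rule_format, of n l r] q_small[rule_format, of n l r] lr disj small M'
      by (intro mult_strict_left_mono add_strict_mono) auto
    also have "\<dots> = e" using M' by (simp add: field_simps)
    finally show "(\<Sum>k<n. norm (\<phi> (r k) - \<phi> (l k))) < e" .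
  qed
qed

lemma absolutely_continuous_on_Icc_ident: "absolutely_continuous_on_Icc a b (\<lambda>t. t)"
  unfolding absolutely_continuous_on_Icc_def
proof (intro allI impI)
  fix e :: real assume "0 < e"
  moreover have "(\<Sum>k<n. norm (r k - l k)) = (\<Sum>k<n. r k - l k)"
    if "\<forall>k<n. a \<le> l k \<and> l k \<le> r k \<and> r k \<le> b" for n :: nat and l r
    using that by (intro sum.cong) auto
  ultimately show "\<exists>\<delta>>0. \<forall>(n::nat) l r. (\<forall>k<n. a \<le> l k \<and> l k \<le> r k \<and> r k \<le> b) \<and>
      disjoint_family_on (\<lambda>k. {l k<..<r k}) {..<n} \<and> (\<Sum>k<n. r k - l k) < \<delta> \<longrightarrow>
      (\<Sum>k<n. norm (r k - l k)) < e"
    by (intro exI[of _ e]) auto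
qed

lemma absolutely_continuous_on_Icc_lipschitz:
  assumes "\<And>l r. a \<le> l \<Longrightarrow> l \<le> r \<Longrightarrow> r \<le> b \<Longrightarrow> norm (\<phi> r - \<phi> l) \<le> M * (r - l)"
  shows "absolutely_continuous_on_Icc a b \<phi>"
proof (rule absolutely_continuous_on_Icc_dominated[OF absolutely_continuous_on_Icc_ident
        absolutely_continuous_on_Icc_ident, of _ _ _ "M / 2"])
  fix l r assume "a \<le> l" "l \<le> r" "r \<le> b"
  with assms[of l r] show "norm (\<phi> r - \<phi> l) \<le> M / 2 * (norm (r - l) + norm (r - l))"
    by (simp add: field_simps)
qed

lemma absolutely_continuous_on_Icc_const: "absolutely_continuous_on_Icc a b (\<lambda>t. c)"
  by (rule absolutely_continuous_on_Icc_lipschitz[of _ _ _ 0]) simp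

lemma absolutely_continuous_on_Icc_add:
  assumes "absolutely_continuous_on_Icc a b p" "absolutely_continuous_on_Icc a b q"
  shows "absolutely_continuous_on_Icc a b (\<lambda>t. p t + q t)"
proof (rule absolutely_continuous_on_Icc_dominated[OF assms, of _ 1])
  fix l r
  show "norm (p r + q r - (p l + q l)) \<le> 1 * (norm (p r - p l) + norm (q r - q l))"
    using norm_triangle_ineq[of "p r - p l" "q r - q l"] by (simp add: algebra_simps)
qed

lemma absolutely_continuous_on_Icc_imp_continuous_on:
  fixes p :: "real \<Rightarrow> 'a::real_normed_vector"
  assumes p: "absolutely_continuous_on_Icc a b p"
  shows "continuous_on {a..b} p"
  unfolding continuous_on_iff
proof (intro ballI allI impI)
  fix s e :: real assume s: "s \<in> {a..b}" and e: "0 < e"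
  obtain \<delta> where \<delta>: "0 < \<delta>" and small: "\<forall>(n::nat) l r. (\<forall>k<n. a \<le> l k \<and> l k \<le> r k \<and> r k \<le> b) \<longrightarrow>
        disjoint_family_on (\<lambda>k. {l k<..<r k}) {..<n} \<longrightarrow> (\<Sum>k<n. r k - l k) < \<delta> \<longrightarrow>
        (\<Sum>k<n. norm (p (r k) - p (l k))) < e"
    using absolutely_continuous_on_IccD[OF p e] by (elim exE conjE) (rule that)
  have "dist (p t) (p s) < e" if t: "t \<in> {a..b}" "dist t s < \<delta>" for t
  proof -
    have "norm (p (max s t) - p (min s t)) < e"
      using small[rule_format, of 1 "\<lambda>_. min s t" "\<lambda>_. max s t"] s t
      by (auto simp: dist_real_def disjoint_family_on_def)
    then show ?thesis by (auto simp: dist_norm max_def min_def norm_minus_commute split: if_splits)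
  qed
  with \<delta> show "\<exists>d>0. \<forall>t\<in>{a..b}. dist t s < d \<longrightarrow> dist (p t) (p s) < e" by blast
qed

lemma absolutely_continuous_on_Icc_inner:
  fixes p q :: "real \<Rightarrow> 'a::real_inner"
  assumes p: "absolutely_continuous_on_Icc a b p" and q: "absolutely_continuous_on_Icc a b q"
  shows "absolutely_continuous_on_Icc a b (\<lambda>t. p t \<bullet> q t)"
proof -
  have "compact (p ` {a..b})" "compact (q ` {a..b})"
    using p q by (auto intro!: compact_continuous_image absolutely_continuous_on_Icc_imp_continuous_on)
  then obtain P Q where P: "\<forall>t\<in>{a..b}. norm (p t) \<le> P" and Q: "\<forall>t\<in>{a..b}. norm (q t) \<le> Q"
    by (auto dest!: compact_imp_bounded simp: bounded_iff)
  show ?thesis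
  proof (rule absolutely_continuous_on_Icc_dominated[OF p q, of _ "max P Q"])
    fix l r assume lr: "a \<le> l" "l \<le> r" "r \<le> b"
    have "p r \<bullet> q r - p l \<bullet> q l = (p r - p l) \<bullet> q l + p r \<bullet> (q r - q l)"
      by (simp add: inner_diff_left inner_diff_right)
    also have "norm \<dots> \<le> norm (p r - p l) * norm (q l) + norm (p r) * norm (q r - q l)"
      by (intro norm_triangle_le add_mono) (simp_all add: Cauchy_Schwarz_ineq2)
    also have "\<dots> \<le> norm (p r - p l) * max P Q + max P Q * norm (q r - q l)"
    proof (intro add_mono mult_left_mono mult_right_mono)
      show "norm (q l) \<le> max P Q" "norm (p r) \<le> max P Q"
        using lr P[rule_format, of r] Q[rule_format, of l] by auto
    qed auto
    finally show "norm (p r \<bullet> q r - p l \<bullet> q l) \<le> max P Q * (norm (p r - p l) + norm (q r - q l))"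
      by (simp add: algebra_simps)
  qed
qed

lemma absolutely_continuous_on_Icc_mult:
  fixes p q :: "real \<Rightarrow> real"
  assumes "absolutely_continuous_on_Icc a b p" "absolutely_continuous_on_Icc a b q"
  shows "absolutely_continuous_on_Icc a b (\<lambda>t. p t * q t)"
  using absolutely_continuous_on_Icc_inner[OF assms] by simp

text \<open>
  Absolute continuity in the form in which it meets a gauge integral: the intervals of a tagged
  partial division that lie in a set of small measure contribute little variation.
\<close>

lemma absolutely_continuous_on_Icc_small_measure:
  fixes \<phi> :: "real \<Rightarrow> 'a::real_normed_vector"
  assumes ac: "absolutely_continuous_on_Icc a b \<phi>" and e: "0 < e"
  shows "\<exists>\<delta>>0. \<forall>D U. D tagged_partial_division_of {a..b} \<and> U \<in> lmeasurable \<and>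
      measure lebesgue U < \<delta> \<and> (\<forall>(x, K)\<in>D. K \<subseteq> U) \<longrightarrow>
      (\<Sum>(x, K)\<in>D. norm (\<phi> (Sup K) - \<phi> (Inf K))) < e"
proof -
  obtain \<delta> where \<delta>: "0 < \<delta>" and small: "\<forall>(n::nat) l r. (\<forall>k<n. a \<le> l k \<and> l k \<le> r k \<and> r k \<le> b) \<longrightarrow>
        disjoint_family_on (\<lambda>k. {l k<..<r k}) {..<n} \<longrightarrow> (\<Sum>k<n. r k - l k) < \<delta> \<longrightarrow>
        (\<Sum>k<n. norm (\<phi> (r k) - \<phi> (l k))) < e"
    using absolutely_continuous_on_IccD[OF ac e] by (elim exE conjE) (rule that)
  show ?thesis
  proof (intro exI[of _ \<delta>] conjI allI impI \<delta>; (elim conjE)?)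
    fix D :: "(real \<times> real set) set" and U
    assume D: "D tagged_partial_division_of {a..b}" and U: "U \<in> lmeasurable" "measure lebesgue U < \<delta>"
      and sub': "\<forall>(x, K)\<in>D. K \<subseteq> U"
    have sub: "K \<subseteq> U" if "(x, K) \<in> D" for x K using sub' that by blast
    note Dd = tagged_partial_division_ofD[OF D]
    obtain h where h: "bij_betw h {..<card D} D"
      using ex_bij_betw_nat_finite[OF Dd(1)] by (auto simp: atLeast0LessThan)
    define l r where "l k = Inf (snd (h k))" and "r k = Sup (snd (h k))" for k
    have hD: "h k \<in> D" if "k < card D" for k
      using h that by (auto dest: bij_betwE)
    have K: "snd (h k) = {l k..r k} \<and> l k \<le> r k" if k: "k < card D" for k
    proof -
      obtain u w where "snd (h k) = {u..w}" "fst (h k) \<in> snd (h k)"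
        using Dd(2,4)[of "fst (h k)" "snd (h k)"] hD[OF k] by auto
      then show ?thesis by (auto simp: l_def r_def)
    qed
    have lr: "\<forall>k<card D. a \<le> l k \<and> l k \<le> r k \<and> r k \<le> b"
    proof (intro allI impI)
      fix k assume k: "k < card D"
      have "snd (h k) \<subseteq> {a..b}" using Dd(3)[of "fst (h k)" "snd (h k)"] hD[OF k] by simp
      with K[OF k] show "a \<le> l k \<and> l k \<le> r k \<and> r k \<le> b" by auto
    qed
    have disj: "disjoint_family_on (\<lambda>k. {l k<..<r k}) {..<card D}"
      unfolding disjoint_family_on_def
    proof (intro ballI impI)
      fix i j assume ij: "i \<in> {..<card D}" "j \<in> {..<card D}" "i \<noteq> j"
      then have "h i \<noteq> h j" using h by (auto simp: bij_betw_def inj_on_def)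
      then have "interior (snd (h i)) \<inter> interior (snd (h j)) = {}"
        using Dd(5)[of "fst (h i)" "snd (h i)" "fst (h j)" "snd (h j)"] hD ij by auto
      then show "{l i<..<r i} \<inter> {l j<..<r j} = {}"
        using K ij by (simp add: interior_atLeastAtMost_real)
    qed
    have "(\<Sum>k<card D. r k - l k) = (\<Sum>k<card D. measure lebesgue {l k<..<r k})"
      using lr by (intro sum.cong) auto
    also have "\<dots> = measure lebesgue (\<Union>k<card D. {l k<..<r k})"
      using disj lr by (intro measure_finite_Union[symmetric]) auto
    also have "\<dots> \<le> measure lebesgue U"
    proof (rule measure_mono_fmeasurable)
      show "(\<Union>k<card D. {l k<..<r k}) \<subseteq> U"
      proof (intro UN_least)
        fix k assume "k \<in> {..<card D}"
        then have k: "k < card D" by simp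
        have "snd (h k) \<subseteq> U" using sub[of "fst (h k)" "snd (h k)"] hD[OF k] by simp
        moreover have "{l k<..<r k} \<subseteq> {l k..r k}"
          by (rule greaterThanLessThan_subseteq_atLeastAtMost_iff[THEN iffD2]) simp
        moreover have "snd (h k) = {l k..r k}" using K[OF k] by blast
        ultimately show "{l k<..<r k} \<subseteq> U" by blast
      qed
    qed (use U in auto)
    finally have "(\<Sum>k<card D. norm (\<phi> (r k) - \<phi> (l k))) < e"
      using U lr disj by (intro small[rule_format]) auto
    also have "(\<Sum>k<card D. norm (\<phi> (r k) - \<phi> (l k))) = (\<Sum>(x, K)\<in>D. norm (\<phi> (Sup K) - \<phi> (Inf K)))"
      unfolding l_def r_def using sum.reindex_bij_betw[OF h, of "\<lambda>(x, K). norm (\<phi> (Sup K) - \<phi> (Inf K))"]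
      by (simp add: case_prod_beta)
    finally show "(\<Sum>(x, K)\<in>D. norm (\<phi> (Sup K) - \<phi> (Inf K))) < e" .
  qed
qed

text \<open>
  A direct gauge argument, which avoids the Lebesgue differentiation theorem. At a point of
  differentiability the gauge is so fine that the increment of \<open>\<phi>\<close> over a tagged interval is at
  most \<open>(g t + e)\<close> times its length; at the exceptional null set the gauge is a small open
  neighbourhood of that set, where absolute continuity bounds the total increment. Telescoping
  over a fine division compares \<open>\<phi> b - \<phi> a\<close> with a Riemann sum of \<open>g\<close>.
\<close>

lemma absolutely_continuous_increment_le_integral:
  fixes \<phi> g :: "real \<Rightarrow> real"
  assumes ab: "a \<le> b" and ac: "absolutely_continuous_on_Icc a b \<phi>" and g: "g integrable_on {a..b}"
    and deriv: "AE t in lebesgue. a < t \<and> t < b \<longrightarrow> (\<exists>d\<le>g t. (\<phi> has_real_derivative d) (at t))"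
  shows "\<phi> b - \<phi> a \<le> integral {a..b} g"
proof -
  from deriv obtain N\<^sub>0 where N\<^sub>0_null: "N\<^sub>0 \<in> null_sets lebesgue" and
      "{t \<in> space lebesgue. \<not> (a < t \<and> t < b \<longrightarrow> (\<exists>d\<le>g t. (\<phi> has_real_derivative d) (at t)))} \<subseteq> N\<^sub>0"
    unfolding eventually_ae_filter by blast
  then have N\<^sub>0: "\<exists>d\<le>g t. (\<phi> has_real_derivative d) (at t)" if "t \<notin> N\<^sub>0" "a < t" "t < b" for t
    using that by auto
  \<comment> \<open>The end points are added because differentiability is known only in the open interval.\<close>
  define N where "N = N\<^sub>0 \<union> {a, b}"
  have "negligible N" unfolding N_def
    using N\<^sub>0_null by (auto simp flip: negligible_iff_null_sets)
  then have null: "N \<in> null_sets lebesgue" by (simp add: negligible_iff_null_sets)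
  define g' where "g' t = (if t \<in> N then 0 else g t)" for t
  have g': "(g' has_integral integral {a..b} g) {a..b}"
    by (rule has_integral_spike[OF \<open>negligible N\<close> _ integrable_integral[OF g]]) (auto simp: g'_def)
  \<comment> \<open>One \<open>e\<close> for the Riemann sum, one for the intervals tagged in the null set, and \<open>e (b - a)\<close> for the
    error in the difference quotients.\<close>
  have main: "\<phi> b - \<phi> a \<le> integral {a..b} g + e * (2 + (b - a))" if e: "0 < e" for e
  proof -
    from g'[unfolded has_integral_real, THEN spec, THEN mp, OF e]
    obtain \<gamma>\<^sub>1 where \<gamma>\<^sub>1: "gauge \<gamma>\<^sub>1"
      and \<gamma>\<^sub>1_sum: "\<forall>D. D tagged_division_of {a..b} \<and> \<gamma>\<^sub>1 fine D \<longrightarrow>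
         norm ((\<Sum>(x,k)\<in>D. measure lborel k *\<^sub>R g' x) - integral {a..b} g) < e"
      by (elim exE conjE) (rule that)
    obtain \<delta> where \<delta>: "0 < \<delta>" and small: "\<forall>D U. D tagged_partial_division_of {a..b} \<and>
      U \<in> lmeasurable \<and> measure lebesgue U < \<delta> \<and> (\<forall>(x, K)\<in>D. K \<subseteq> U) \<longrightarrow>
      (\<Sum>(x, K)\<in>D. norm (\<phi> (Sup K) - \<phi> (Inf K))) < e"
      using absolutely_continuous_on_Icc_small_measure[OF ac e] by blast
    obtain U where U: "open U" "N \<subseteq> U" "U - N \<in> lmeasurable" "emeasure lebesgue (U - N) < ennreal \<delta>"
      using sets_lebesgue_outer_open[of N \<delta>] null \<delta> by auto
    have U_lm: "U \<in> lmeasurable"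
      using fmeasurable.Un[OF U(3), of N] null U(2)
      by (metis Diff_partition Un_commute fmeasurableI_null_sets)
    have "measure lebesgue U < \<delta>"
      using U(4) emeasure_Diff_null_set[OF null fmeasurableD[OF U_lm]] U_lm
      by (simp add: emeasure_eq_measure2 ennreal_less_iff)
    have "\<exists>r>0. t \<in> {a<..<b} - N \<longrightarrow> (\<forall>u w. u \<le> t \<longrightarrow> t \<le> w \<longrightarrow> t - u < r \<longrightarrow> w - t < r \<longrightarrow>
             \<phi> w - \<phi> u \<le> (g t + e) * (w - u))" for t
    proof (cases "t \<in> {a<..<b} - N")
      case True
      then obtain d where d: "d \<le> g t" "(\<phi> has_real_derivative d) (at t)"
        using N\<^sub>0[of t] by (auto simp: N_def)
      then obtain r where r: "0 < r"
        "\<And>y. norm (y - t) < r \<Longrightarrow> norm (\<phi> y - \<phi> t - d * (y - t)) \<le> e * norm (y - t)"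
        using e unfolding has_field_derivative_def has_derivative_within_alt by auto
      have "\<phi> w - \<phi> u \<le> (g t + e) * (w - u)" if "u \<le> t" "t \<le> w" "t - u < r" "w - t < r" for u w
      proof -
        have "\<phi> w - \<phi> t - d * (w - t) \<le> e * (w - t)" "\<phi> t - \<phi> u + d * (u - t) \<le> e * (t - u)"
          using r(2)[of w] r(2)[of u] that by auto
        then have "\<phi> w - \<phi> u \<le> (d + e) * (w - u)" by (simp add: algebra_simps)
        also have "\<dots> \<le> (g t + e) * (w - u)" using d that by (intro mult_right_mono) auto
        finally show ?thesis .
      qed
      with r(1) show ?thesis by blast
    qed (auto intro: exI[of _ 1])
    then obtain r where r: "\<And>t. 0 < r t"
      "\<And>t u w. t \<in> {a<..<b} - N \<Longrightarrow> u \<le> t \<Longrightarrow> t \<le> w \<Longrightarrow> t - u < r t \<Longrightarrow> w - t < r t \<Longrightarrow>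
             \<phi> w - \<phi> u \<le> (g t + e) * (w - u)"
      by metis
    define \<gamma>\<^sub>2 where "\<gamma>\<^sub>2 t = (if t \<in> N then U else ball t (r t))" for t
    have "gauge (\<lambda>t. \<gamma>\<^sub>1 t \<inter> \<gamma>\<^sub>2 t)"
      using \<gamma>\<^sub>1 U(1,2) r(1) by (auto simp: gauge_def \<gamma>\<^sub>2_def)
    then obtain D where D: "D tagged_division_of {a..b}" "(\<lambda>t. \<gamma>\<^sub>1 t \<inter> \<gamma>\<^sub>2 t) fine D"
      using fine_division_exists_real by blast
    have fine: "\<gamma>\<^sub>1 fine D" "\<And>x K. (x, K) \<in> D \<Longrightarrow> K \<subseteq> \<gamma>\<^sub>2 x" using D(2) by (auto simp: fine_def)
    note Dd = tagged_division_ofD[OF D(1)]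
    define D\<^sub>1 where "D\<^sub>1 = {p \<in> D. fst p \<in> N}"
    have D1: "D\<^sub>1 tagged_partial_division_of {a..b}"
      using D(1)
      by - (rule tagged_partial_division_subset[of D], auto simp: D\<^sub>1_def tagged_division_of_def)
    have bad: "(\<Sum>(x, K)\<in>D\<^sub>1. norm (\<phi> (Sup K) - \<phi> (Inf K))) < e"
    proof -
      have "\<forall>(x, K)\<in>D\<^sub>1. K \<subseteq> U" using fine(2) by (force simp: D\<^sub>1_def \<gamma>\<^sub>2_def)
      with D1 U_lm \<open>measure lebesgue U < \<delta>\<close> small show ?thesis by blast
    qed
    have pt: "\<phi> (Sup K) - \<phi> (Inf K) \<le> measure lborel K *\<^sub>R g' x + e * measure lborel K
        + (if x \<in> N then norm (\<phi> (Sup K) - \<phi> (Inf K)) else 0)" if xK: "(x, K) \<in> D" for x K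
    proof -
      obtain u w where uw: "K = {u..w}" using Dd(4)[OF xK] by auto
      with Dd(2,3)[OF xK] have *: "u \<le> x" "x \<le> w" "a \<le> u" "w \<le> b" by auto
      have content: "measure lborel K = w - u" using * uw by simp
      have InfSup: "Inf K = u" "Sup K = w" using * uw by auto
      show ?thesis
      proof (cases "x \<in> N")
        case True
        have "0 \<le> e * (w - u)" using e * by simp
        with True show ?thesis using abs_ge_self[of "\<phi> w - \<phi> u"] by (simp add: g'_def content InfSup)
      next
        case False
        with * have "x \<noteq> a" "x \<noteq> b" by (auto simp: N_def)
        with * False have x: "x \<in> {a<..<b} - N" by auto
        have "K \<subseteq> ball x (r x)" using fine(2)[OF xK] False by (simp add: \<gamma>\<^sub>2_def)
        moreover have "u \<in> K" "w \<in> K" using uw * by auto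
        ultimately have "u \<in> ball x (r x)" "w \<in> ball x (r x)" by blast+
        then have "\<phi> w - \<phi> u \<le> (g x + e) * (w - u)"
          using * by (intro r(2)[OF x]) (auto simp: dist_real_def)
        with False show ?thesis by (simp add: g'_def content InfSup algebra_simps)
      qed
    qed
    have "\<phi> b - \<phi> a = (\<Sum>(x, K)\<in>D. \<phi> (Sup K) - \<phi> (Inf K))"
      by (rule additive_tagged_division_1[OF ab D(1), symmetric])
    also have "\<dots> \<le> (\<Sum>(x, K)\<in>D. measure lborel K *\<^sub>R g' x + e * measure lborel K
        + (if x \<in> N then norm (\<phi> (Sup K) - \<phi> (Inf K)) else 0))"
      using pt by (intro sum_mono) auto
    also have "\<dots> = (\<Sum>(x, K)\<in>D. measure lborel K *\<^sub>R g' x) + e * (\<Sum>(x, K)\<in>D. measure lborel K)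
        + (\<Sum>(x, K)\<in>D. if x \<in> N then norm (\<phi> (Sup K) - \<phi> (Inf K)) else 0)"
      by (simp add: case_prod_beta sum.distrib sum_distrib_left)
    also have "(\<Sum>(x, K)\<in>D. measure lborel K) = b - a"
      using additive_content_tagged_division[of D a b] D(1) ab by (simp add: box_real)
    also have "(\<Sum>(x, K)\<in>D. if x \<in> N then norm (\<phi> (Sup K) - \<phi> (Inf K)) else 0)
        = (\<Sum>(x, K)\<in>D\<^sub>1. norm (\<phi> (Sup K) - \<phi> (Inf K)))"
      unfolding D\<^sub>1_def using Dd(1) by (simp add: sum.inter_filter case_prod_beta del: real_norm_def)
    finally show ?thesis
      using bad \<gamma>\<^sub>1_sum[THEN spec, THEN mp, OF conjI[OF D(1) fine(1)]]
      by (simp add: algebra_simps)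
  qed
  show ?thesis
  proof (rule field_le_epsilon)
    fix e :: real assume "0 < e"
    then show "\<phi> b - \<phi> a \<le> integral {a..b} g + e"
      using main[of "e / (2 + (b - a))"] ab by simp
  qed
qed

section \<open>Asymptotics of real functions\<close>

text \<open>
  Both \<open>G\<close> and \<open>G - Q\<close> are increasing and bounded above.
\<close>

lemma bounded_increments_tendsto:
  fixes Q G :: "real \<Rightarrow> real"
  assumes incr: "\<And>s t. a \<le> s \<Longrightarrow> s \<le> t \<Longrightarrow> Q t - Q s \<le> G t - G s"
    and G_mono: "\<And>s t. a \<le> s \<Longrightarrow> s \<le> t \<Longrightarrow> G s \<le> G t"
    and G_bound: "\<And>t. a \<le> t \<Longrightarrow> G t \<le> C" and Q_bound: "\<And>t. a \<le> t \<Longrightarrow> c \<le> Q t"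
  obtains q where "(Q \<longlongrightarrow> q) at_top"
proof -
  have mono_lim: "\<exists>l. (F \<longlongrightarrow> l) at_top"
    if F_mono: "\<And>s t. a \<le> s \<Longrightarrow> s \<le> t \<Longrightarrow> F s \<le> F t" and F_bound: "\<And>t. a \<le> t \<Longrightarrow> F t \<le> B"
    for F :: "real \<Rightarrow> real" and B
  proof -
    define l where "l = (SUP t\<in>{a..}. F t)"
    have bdd: "bdd_above (F ` {a..})" using F_bound by (intro bdd_aboveI[of _ B]) auto
    have "(F \<longlongrightarrow> l) at_top"
    proof (rule order_tendstoI)
      fix y assume "y < l"
      then obtain s where s: "a \<le> s" "y < F s"
        unfolding l_def using less_cSUP_iff[OF _ bdd] by auto
      show "\<forall>\<^sub>F t in at_top. y < F t"
        using eventually_ge_at_top[of s]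
        by eventually_elim (use s F_mono in \<open>auto intro: less_le_trans\<close>)
    next
      fix y assume y: "l < y"
      show "\<forall>\<^sub>F t in at_top. F t < y"
        using eventually_ge_at_top[of a]
      proof eventually_elim
        case (elim t)
        then have "F t \<le> l" unfolding l_def by (intro cSUP_upper bdd) auto
        with y show ?case by simp
      qed
    qed
    then show ?thesis ..
  qed
  obtain g where g: "(G \<longlongrightarrow> g) at_top" using mono_lim[of G C] G_mono G_bound by metis
  have "\<exists>l. ((\<lambda>t. G t - Q t) \<longlongrightarrow> l) at_top"
  proof (rule mono_lim[of _ "C - c"])
    fix s t assume "a \<le> s" "s \<le> t" then show "G s - Q s \<le> G t - Q t" using incr by fastforce
  next
    fix t assume "a \<le> t" then show "G t - Q t \<le> C - c" using G_bound[of t] Q_bound[of t] by linarith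
  qed
  then obtain l where "((\<lambda>t. G t - Q t) \<longlongrightarrow> l) at_top" ..
  from tendsto_diff[OF g this] show thesis by (intro that[of "g - l"]) simp
qed

text \<open>
  The expression \<open>t h' + \<beta> h\<close> is the quotient of the derivatives of \<open>t\<^sup>\<beta> h\<close> and \<open>t\<^sup>\<beta>/\<beta>\<close>, so
  l'Hospital's rule passes from its limit to the limit of \<open>h\<close>.
\<close>

lemma tendsto_of_weighted_derivative:
  fixes h h' :: "real \<Rightarrow> real"
  assumes \<beta>: "0 < \<beta>" and deriv: "\<And>t. a < t \<Longrightarrow> (h has_real_derivative h' t) (at t)"
    and lim: "((\<lambda>t. t * h' t + \<beta> * h t) \<longlongrightarrow> l) at_top"
  shows "(h \<longlongrightarrow> l / \<beta>) at_top"
proof -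
  have pos: "\<forall>\<^sub>F t in at_top. max 0 a < t" by (rule eventually_gt_at_top)
  have "((\<lambda>t. (t powr \<beta> * h t) / t powr \<beta>) \<longlongrightarrow> l / \<beta>) at_top"
  proof (rule lhospital_at_top_at_top)
    show "LIM t at_top. t powr \<beta> :> at_top" by (rule real_powr_at_top[OF \<beta>])
    show "\<forall>\<^sub>F t in at_top. \<beta> * t powr (\<beta> - 1) \<noteq> 0"
      using pos by eventually_elim (use \<beta> in auto)
    show "\<forall>\<^sub>F t in at_top. ((\<lambda>t. t powr \<beta>) has_real_derivative \<beta> * t powr (\<beta> - 1)) (at t)"
      using pos by eventually_elim (auto intro!: has_real_derivative_powr)
    show "\<forall>\<^sub>F t in at_top. ((\<lambda>t. t powr \<beta> * h t) has_real_derivative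
        \<beta> * t powr (\<beta> - 1) * h t + t powr \<beta> * h' t) (at t)"
      using pos
    proof eventually_elim
      case (elim t)
      then show ?case
        using DERIV_mult[OF has_real_derivative_powr[of t \<beta>] deriv[of t]] by (simp add: mult.commute)
    qed
    have "\<forall>\<^sub>F t in at_top. (t * h' t + \<beta> * h t) / \<beta> =
        (\<beta> * t powr (\<beta> - 1) * h t + t powr \<beta> * h' t) / (\<beta> * t powr (\<beta> - 1))"
      using pos
    proof eventually_elim
      case (elim t)
      then have "t powr \<beta> = t * t powr (\<beta> - 1)" by (simp add: powr_mult_base)
      with elim \<beta> show ?case by (simp add: field_simps)
    qed
    then show "((\<lambda>t. (\<beta> * t powr (\<beta> - 1) * h t + t powr \<beta> * h' t) / (\<beta> * t powr (\<beta> - 1)))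
        \<longlongrightarrow> l / \<beta>) at_top"
      by (rule Lim_transform_eventually[rotated]) (intro tendsto_divide lim tendsto_const; use \<beta> in simp)
  qed
  moreover have "\<forall>\<^sub>F t in at_top. (t powr \<beta> * h t) / t powr \<beta> = h t"
    using pos by eventually_elim auto
  ultimately show ?thesis by (rule Lim_transform_eventually)
qed

text \<open>
  In the variable \<open>log t\<close> the function \<open>\<psi>\<close> is Lipschitz and square integrable. If \<open>|\<psi> t| \<ge> \<eta>\<close>,
  then \<open>|\<psi>| \<ge> \<eta>/2\<close> on \<open>[t, (1 + \<theta>) t]\<close> for a \<open>\<theta>\<close> that does not depend on \<open>t\<close>, and this interval
  contributes a fixed amount \<open>\<rho>\<close> to the integral. That can happen only for bounded \<open>t\<close>.
\<close>

lemma log_lipschitz_tendsto_0: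
  fixes \<psi> :: "real \<Rightarrow> real"
  assumes a: "0 < a" and C: "0 \<le> C"
    and lip: "\<And>s t. a \<le> s \<Longrightarrow> s \<le> t \<Longrightarrow> \<bar>\<psi> t - \<psi> s\<bar> \<le> C * (t - s) / s"
    and cont: "continuous_on {a..} \<psi>"
    and bound: "\<And>t. a \<le> t \<Longrightarrow> integral {a..t} (\<lambda>s. (\<psi> s)\<^sup>2 / s) \<le> B"
  shows "(\<psi> \<longlongrightarrow> 0) at_top"
proof (rule tendstoI)
  fix \<eta> :: real assume \<eta>: "0 < \<eta>"
  define \<theta> where "\<theta> = \<eta> / (2 * (C + 1))"
  define \<rho> where "\<rho> = (\<eta> / 2)\<^sup>2 * \<theta> / (1 + \<theta>)"
  have \<theta>: "0 < \<theta>" "C * \<theta> \<le> \<eta> / 2" using \<eta> C by (auto simp: \<theta>_def field_simps)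
  have \<rho>: "0 < \<rho>" using \<eta> \<theta> by (simp add: \<rho>_def)
  define \<gamma> where "\<gamma> t = integral {a..t} (\<lambda>s. (\<psi> s)\<^sup>2 / s)" for t
  have int: "(\<lambda>s. (\<psi> s)\<^sup>2 / s) integrable_on {s..t}" if "a \<le> s" for s t
    using that a by (intro integrable_continuous_real continuous_intros
        continuous_on_subset[OF cont]) auto
  have \<gamma>_diff: "\<gamma> t - \<gamma> s = integral {s..t} (\<lambda>s. (\<psi> s)\<^sup>2 / s)" if "a \<le> s" "s \<le> t" for s t
    using Henstock_Kurzweil_Integration.integral_combine[OF that int[of a t]] unfolding \<gamma>_def by simp
  have \<gamma>_mono: "\<gamma> s \<le> \<gamma> t" if "a \<le> s" "s \<le> t" for s t
  proof -
    have "0 \<le> \<gamma> t - \<gamma> s" unfolding \<gamma>_diff[OF that]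
      by (rule integral_nonneg[OF int]) (use a that in auto)
    then show ?thesis by simp
  qed
  obtain l where l: "(\<gamma> \<longlongrightarrow> l) at_top"
  proof (rule bounded_increments_tendsto[of a \<gamma> \<gamma> B "\<gamma> a"])
    show "\<gamma> t \<le> B" if "a \<le> t" for t using bound[OF that] by (simp add: \<gamma>_def)
  qed (use \<gamma>_mono in auto)
  have "\<forall>\<^sub>F t in at_top. dist (\<gamma> t) l < \<rho> / 2" by (rule tendstoD[OF l]) (use \<rho> in simp)
  then obtain T where T: "\<And>t. T \<le> t \<Longrightarrow> dist (\<gamma> t) l < \<rho> / 2"
    unfolding eventually_at_top_linorder by blast
  show "\<forall>\<^sub>F t in at_top. dist (\<psi> t) 0 < \<eta>"
    using eventually_ge_at_top[of "max a T"]
  proof eventually_elim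
    case (elim t)
    show ?case
    proof (rule ccontr)
      assume "\<not> ?case"
      then have big: "\<eta> \<le> \<bar>\<psi> t\<bar>" by simp
      define t' where "t' = (1 + \<theta>) * t"
      have t: "a \<le> t" "T \<le> t" "0 < t" using elim a by auto
      have t': "t \<le> t'" "t' - t = \<theta> * t" using t \<theta> by (auto simp: t'_def algebra_simps)
      have lower: "(\<eta> / 2)\<^sup>2 / t' \<le> (\<psi> s)\<^sup>2 / s" if s: "s \<in> {t..t'}" for s
      proof -
        have "\<bar>\<psi> s - \<psi> t\<bar> \<le> C * (s - t) / t" using lip[of t s] t s by simp
        also have "\<dots> \<le> C * (\<theta> * t) / t"
          using C t t' s by (intro divide_right_mono mult_left_mono) auto
        also have "\<dots> \<le> \<eta> / 2" using \<theta> t by simp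
        finally have "\<eta> / 2 \<le> \<bar>\<psi> s\<bar>" using big by linarith
        then have "(\<eta> / 2)\<^sup>2 \<le> (\<psi> s)\<^sup>2" using \<eta> by (metis abs_le_square_iff abs_of_pos half_gt_zero)
        then show ?thesis using s t by (intro frac_le) auto
      qed
      have "w * \<theta> / (1 + \<theta>) = \<theta> * t * (w / ((1 + \<theta>) * t))" for w
        using t \<theta>(1) by simp
      then have "\<rho> = (t' - t) * ((\<eta> / 2)\<^sup>2 / t')"
        unfolding t'(2) unfolding t'_def \<rho>_def by blast
      also have "\<dots> = integral {t..t'} (\<lambda>s. (\<eta> / 2)\<^sup>2 / t')" using t' by simp
      also have "\<dots> \<le> integral {t..t'} (\<lambda>s. (\<psi> s)\<^sup>2 / s)"
        using lower t by (intro integral_le int) auto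
      also have "\<dots> = \<gamma> t' - \<gamma> t" using \<gamma>_diff t t' by simp
      finally show False using T[of t] T[of t'] t t'(1) unfolding dist_real_def by linarith
    qed
  qed
qed

section \<open>Energy estimates for the damped trajectory\<close>

definition yosida_index :: "real \<Rightarrow> real \<Rightarrow> real \<Rightarrow> real" where
  "yosida_index \<alpha> \<epsilon> t = (1 + \<epsilon>) * (t\<^sup>2 / \<alpha>\<^sup>2)"

lemma has_real_derivative_inner:
  fixes p q :: "real \<Rightarrow> 'a::real_inner"
  assumes "(p has_vector_derivative p') (at t)" "(q has_vector_derivative q') (at t)"
  shows "((\<lambda>t. p t \<bullet> q t) has_real_derivative (p t \<bullet> q' + p' \<bullet> q t)) (at t)"
  unfolding has_real_derivative_iff_has_vector_derivative
  by (rule bounded_bilinear.has_vector_derivative[OF bounded_bilinear_inner assms])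

text \<open>
  The energy estimates see the operator only through the curve \<open>y\<close>, which stands for \<open>A\<^sub>\<lambda> x\<close>. What
  they need about a zero \<open>z\<close> is the inequality \<open>\<lambda> |y|\<^sup>2 \<le> \<langle>x - z, y\<rangle>\<close>, called \<open>coercive\<close> below.
\<close>

locale damped_trajectory =
  fixes x v y f :: "real \<Rightarrow> 'a::real_inner" and t\<^sub>0 \<alpha> \<epsilon> :: real
  assumes t0_pos: "0 < t\<^sub>0" and \<alpha>_gt: "2 < \<alpha>" and \<epsilon>_gt: "4 / (\<alpha> - 2) < \<epsilon>"
    and x_deriv: "\<And>t. t\<^sub>0 \<le> t \<Longrightarrow> (x has_vector_derivative v t) (at t within {t\<^sub>0..})"
    and v_cont: "continuous_on {t\<^sub>0..} v"
    and v_ac: "\<And>a b. t\<^sub>0 \<le> a \<Longrightarrow> absolutely_continuous_on_Icc a b v"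
    and y_cont: "continuous_on {t\<^sub>0..} y"
    and ode: "AE t in lebesgue. t > t\<^sub>0 \<longrightarrow>
        (\<exists>a. (v has_vector_derivative a) (at t) \<and> a + (\<alpha> / t) *\<^sub>R v t + y t = f t)"
    and f_cubic: "set_integrable lebesgue {t\<^sub>0..} (\<lambda>t. t ^ 3 * (norm (f t))\<^sup>2)"
    and f_linear: "set_integrable lebesgue {t\<^sub>0..} (\<lambda>t. t * norm (f t))"
begin

abbreviation lam :: "real \<Rightarrow> real" where "lam \<equiv> yosida_index \<alpha> \<epsilon>"

definition kinetic :: "real \<Rightarrow> real" where "kinetic t = t * (norm (v t))\<^sup>2"

definition forcing :: "real \<Rightarrow> real" where "forcing t = t * norm (f t)"

definition cubic :: "real \<Rightarrow> real" where "cubic t = t ^ 3 * (norm (f t))\<^sup>2"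

text \<open>
  With \<open>h = |x - z|\<^sup>2/2\<close> this is \<open>t h' + (\<alpha> - 1) h\<close>, whose derivative is \<open>t h'' + \<alpha> h'\<close>: the
  damped second derivative of \<open>h\<close>, multiplied by \<open>t\<close>.
\<close>

definition anchor :: "'a \<Rightarrow> real \<Rightarrow> real" where
  "anchor z t = t * ((x t - z) \<bullet> v t) + (\<alpha> - 1) / 2 * ((x t - z) \<bullet> (x t - z))"

lemma \<epsilon>_pos: "0 < \<epsilon>"
  using \<epsilon>_gt \<alpha>_gt by (smt (verit) divide_pos_pos)

lemma lam_pos: "0 < t \<Longrightarrow> 0 < lam t"
  using \<epsilon>_pos \<alpha>_gt by (simp add: yosida_index_def)

lemma x_deriv_at: "t\<^sub>0 < t \<Longrightarrow> (x has_vector_derivative v t) (at t)"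
  using x_deriv[of t] at_within_interior[of t "{t\<^sub>0..}"] by (simp add: interior_real_atLeast)

lemma x_increment:
  assumes s: "t\<^sub>0 \<le> s" "s \<le> t" and M: "\<And>r. r \<in> {s..t} \<Longrightarrow> norm (v r) \<le> M"
  shows "norm (x t - x s) \<le> M * (t - s)"
proof -
  have "norm (x t - x s) \<le> M * norm (t - s)"
  proof (rule differentiable_bound[of "{s..t}" x "\<lambda>r h. h *\<^sub>R v r"])
    fix r assume r: "r \<in> {s..t}"
    have "(x has_vector_derivative v r) (at r within {s..t})"
      by (rule has_vector_derivative_within_subset[OF x_deriv]) (use r s in auto)
    then show "(x has_derivative (\<lambda>h. h *\<^sub>R v r)) (at r within {s..t})"
      by (simp add: has_vector_derivative_def)
    show "onorm (\<lambda>h. h *\<^sub>R v r) \<le> M"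
      by (rule onorm_le) (use M[OF r] in \<open>simp add: mult.commute[of M] mult_left_mono\<close>)
  qed (use s in auto)
  with s show ?thesis by simp
qed

lemma x_cont: "continuous_on {t\<^sub>0..} x"
  unfolding continuous_on_eq_continuous_within
  by (intro ballI has_vector_derivative_continuous[OF x_deriv]) simp

lemma x_ac:
  assumes "t\<^sub>0 \<le> a"
  shows "absolutely_continuous_on_Icc a b x"
proof -
  have "compact (v ` {a..b})"
    using assms by (intro compact_continuous_image continuous_on_subset[OF v_cont]) auto
  then obtain M where "\<forall>t\<in>{a..b}. norm (v t) \<le> M"
    by (auto dest!: compact_imp_bounded simp: bounded_iff)
  then show ?thesis
    using assms by (intro absolutely_continuous_on_Icc_lipschitz[of _ _ _ M] x_increment) auto
qed

lemma x_diff_ac: "t\<^sub>0 \<le> a \<Longrightarrow> absolutely_continuous_on_Icc a b (\<lambda>t. x t - z)"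
  using absolutely_continuous_on_Icc_add[OF x_ac absolutely_continuous_on_Icc_const[of a b "- z"]]
  by simp

lemma anchor_ac: "t\<^sub>0 \<le> a \<Longrightarrow> absolutely_continuous_on_Icc a b (anchor z)"
  unfolding anchor_def[abs_def]
  by (intro absolutely_continuous_on_Icc_add absolutely_continuous_on_Icc_mult
      absolutely_continuous_on_Icc_inner
      absolutely_continuous_on_Icc_ident absolutely_continuous_on_Icc_const x_diff_ac v_ac)

lemma anchor_deriv:
  assumes t: "t\<^sub>0 < t" and a: "(v has_vector_derivative a) (at t)"
    and eq: "a + (\<alpha> / t) *\<^sub>R v t + y t = f t"
  shows "(anchor z has_real_derivative
      kinetic t + t * ((x t - z) \<bullet> f t) - t * ((x t - z) \<bullet> y t)) (at t)"
proof -
  have X: "((\<lambda>t. x t - z) has_vector_derivative v t) (at t)"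
    using has_vector_derivative_diff[OF x_deriv_at[OF t] has_vector_derivative_const[of z]] by simp
  have a_eq: "a = f t - (\<alpha> / t) *\<^sub>R v t - y t" using eq by (simp add: algebra_simps)
  have "(anchor z has_real_derivative (1 * ((x t - z) \<bullet> v t) + ((x t - z) \<bullet> a + v t \<bullet> v t) * t)
      + (\<alpha> - 1) / 2 * ((x t - z) \<bullet> v t + v t \<bullet> (x t - z))) (at t)"
    unfolding anchor_def[abs_def]
    by (intro DERIV_add DERIV_mult DERIV_cmult DERIV_ident has_real_derivative_inner X a)
  moreover have "(1 * ((x t - z) \<bullet> v t) + ((x t - z) \<bullet> a + v t \<bullet> v t) * t)
      + (\<alpha> - 1) / 2 * ((x t - z) \<bullet> v t + v t \<bullet> (x t - z))
      = kinetic t + t * ((x t - z) \<bullet> f t) - t * ((x t - z) \<bullet> y t)"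
  proof -
    define X where "X = x t - z"
    have "t \<noteq> 0" using t t0_pos by simp
    then show ?thesis unfolding kinetic_def a_eq X_def[symmetric]
      by (simp add: power2_norm_eq_inner inner_diff_right inner_add_right
          inner_commute[of "v t" X] field_simps)
  qed
  ultimately show ?thesis by simp
qed

lemma forcing_nonneg: "t\<^sub>0 \<le> t \<Longrightarrow> 0 \<le> forcing t"
  using t0_pos by (simp add: forcing_def)

lemma integrable_forcing: "t\<^sub>0 \<le> a \<Longrightarrow> forcing integrable_on {a..b}"
  using set_lebesgue_integral_eq_integral(1)[OF set_integrable_subset[OF f_linear, of "{a..b}"]]
  by (auto simp: forcing_def[abs_def])

lemma integrable_cubic: "t\<^sub>0 \<le> a \<Longrightarrow> cubic integrable_on {a..b}"
  using set_lebesgue_integral_eq_integral(1)[OF set_integrable_subset[OF f_cubic, of "{a..b}"]]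
  by (auto simp: cubic_def[abs_def])

lemma integral_forcing_le: "integral {t\<^sub>0..b} forcing \<le> integral {t\<^sub>0..} forcing"
  using set_lebesgue_integral_eq_integral(1)[OF f_linear] forcing_nonneg
  by (intro integral_subset_le integrable_forcing) (auto simp: forcing_def[abs_def])

lemma integral_cubic_le: "integral {t\<^sub>0..b} cubic \<le> integral {t\<^sub>0..} cubic"
  using set_lebesgue_integral_eq_integral(1)[OF f_cubic] t0_pos
  by (intro integral_subset_le integrable_cubic) (auto simp: cubic_def[abs_def])

lemma integrable_kinetic: "t\<^sub>0 \<le> a \<Longrightarrow> kinetic integrable_on {a..b}"
  unfolding kinetic_def[abs_def]
  by (intro integrable_continuous_real continuous_intros continuous_on_subset[OF v_cont]) auto

lemma inner_forcing_le:
  assumes t: "t\<^sub>0 \<le> t" and M: "norm (x t - z) \<le> M"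
  shows "t * ((x t - z) \<bullet> f t) \<le> M * forcing t"
proof -
  have "(x t - z) \<bullet> f t \<le> norm (x t - z) * norm (f t)" by (rule norm_cauchy_schwarz)
  also have "\<dots> \<le> M * norm (f t)" using M by (rule mult_right_mono) simp
  finally show ?thesis
    using mult_left_mono[of "(x t - z) \<bullet> f t" "M * norm (f t)" t] t t0_pos
    by (simp add: forcing_def mult.left_commute)
qed

text \<open>
  This is \<open>(1 + \<epsilon>')/\<alpha>\<close> for \<open>\<epsilon>' = 4/(\<alpha> - 2)\<close>. As \<open>\<epsilon>\<close> is larger than \<open>\<epsilon>'\<close>, replacing it by \<open>\<epsilon>'\<close>
  frees a part of \<open>\<lambda> |y|\<^sup>2\<close>, with which the forcing term can be separated by Young's inequality.
\<close>

definition c :: real where "c = (\<alpha> + 2) / (\<alpha> * (\<alpha> - 2))"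

definition lyapunov :: "'a \<Rightarrow> real \<Rightarrow> real" where
  "lyapunov z t = anchor z t + c * (t * (t * (v t \<bullet> v t)))"

definition \<eta> :: real where "\<eta> = 1 - c * \<alpha> / (1 + \<epsilon>)"

definition K :: real where "K = (1 + \<epsilon>) / \<alpha>\<^sup>2 * (1 / \<eta> - 1)"

text \<open>
  The fraction of \<open>\<lambda>\<close> that is given up for this purpose: \<open>(1 - \<eta>) (1 + \<epsilon>) = 1 + \<epsilon>'\<close>.
\<close>

lemma \<eta>_bounds: "0 < \<eta>" "\<eta> < 1"
proof -
  have "c * \<alpha> = 1 + 4 / (\<alpha> - 2)" using \<alpha>_gt by (simp add: c_def field_simps)
  moreover have "0 < 4 / (\<alpha> - 2)" using \<alpha>_gt by simp
  ultimately have "0 < c * \<alpha>" "c * \<alpha> < 1 + \<epsilon>" using \<epsilon>_gt by linarith+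
  then show "0 < \<eta>" "\<eta> < 1" using \<epsilon>_pos by (simp_all add: \<eta>_def)
qed

lemma c_gt: "1 / (\<alpha> - 1) < c"
proof -
  have "\<alpha> * (\<alpha> - 2) < (\<alpha> + 2) * (\<alpha> - 1)" using \<alpha>_gt by (simp add: algebra_simps)
  then show ?thesis using \<alpha>_gt by (simp add: c_def divide_simps mult.commute)
qed

lemma K_nonneg: "0 \<le> K"
  using \<eta>_bounds \<epsilon>_pos by (simp add: K_def)

lemma lyapunov_ac: "t\<^sub>0 \<le> a \<Longrightarrow> absolutely_continuous_on_Icc a b (lyapunov z)"
  unfolding lyapunov_def[abs_def]
  by (intro absolutely_continuous_on_Icc_add absolutely_continuous_on_Icc_mult
      absolutely_continuous_on_Icc_inner
      absolutely_continuous_on_Icc_ident absolutely_continuous_on_Icc_const anchor_ac v_ac)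

text \<open>
  The quadratic form is positive definite because \<open>c (\<alpha> - 1) > 1\<close>; the cross term is absorbed by
  expanding the square of \<open>(\<alpha> - 1) (x - z) + 2 t v\<close>.
\<close>

lemma lyapunov_lower:
  assumes "t\<^sub>0 \<le> t"
  shows "(norm (x t - z))\<^sup>2 / 4 + (c - 1 / (\<alpha> - 1)) * (t * norm (v t))\<^sup>2 \<le> lyapunov z t"
proof -
  define X where "X = x t - z"
  define m where "m = \<alpha> - 1"
  have m: "1 < m" using \<alpha>_gt by (simp add: m_def)
  have "0 \<le> (norm (m *\<^sub>R X + (2 * t) *\<^sub>R v t))\<^sup>2" by simp
  also have "\<dots> = m\<^sup>2 * (norm X)\<^sup>2 + 4 * m * (t * (X \<bullet> v t)) + 4 * (t * norm (v t))\<^sup>2"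
    unfolding norm_add_scaleR_power2
    by (simp add: power_mult_distrib power2_eq_square[of "norm (m *\<^sub>R X)"] power2_eq_square)
  finally have "0 \<le> (m\<^sup>2 * (norm X)\<^sup>2 + 4 * m * (t * (X \<bullet> v t)) + 4 * (t * norm (v t))\<^sup>2) / (4 * m)"
    using m by simp
  also have "\<dots> = m / 4 * (norm X)\<^sup>2 + t * (X \<bullet> v t) + 1 / m * (t * norm (v t))\<^sup>2"
    using m by (simp add: field_simps power2_eq_square)
  finally have 1: "- (m / 4 * (norm X)\<^sup>2) - 1 / m * (t * norm (v t))\<^sup>2 \<le> t * (X \<bullet> v t)" by linarith
  have 2: "(norm X)\<^sup>2 / 4 \<le> m / 4 * (norm X)\<^sup>2"
    using mult_right_mono[of 1 m "(norm X)\<^sup>2"] m by simp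
  have "lyapunov z t = t * (X \<bullet> v t) + m / 2 * (norm X)\<^sup>2 + c * (t * norm (v t))\<^sup>2"
    by (simp add: lyapunov_def anchor_def X_def m_def power2_norm_eq_inner
        power_mult_distrib power2_eq_square[of t])
  with 1 2 show ?thesis by (simp add: algebra_simps flip: X_def m_def)
qed

text \<open>
  Young's inequality \<open>|g - b|\<^sup>2 \<ge> (1 - \<eta>) |b|\<^sup>2 - (1/\<eta> - 1) |g|\<^sup>2\<close>, obtained from the square of
  \<open>\<eta> b - g\<close>, with the constants evaluated for the given index.
\<close>

lemma lam_norm_ge:
  fixes b g :: 'a
  assumes "0 < t"
  shows "c * t\<^sup>2 / \<alpha> * (norm b)\<^sup>2 - K * t\<^sup>2 * (norm g)\<^sup>2 \<le> lam t * (norm (g - b))\<^sup>2"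
proof -
  have "0 \<le> (norm (\<eta> *\<^sub>R b + (- 1) *\<^sub>R g))\<^sup>2" by simp
  also have "\<dots> = \<eta>\<^sup>2 * (norm b)\<^sup>2 - 2 * \<eta> * (b \<bullet> g) + (norm g)\<^sup>2"
    unfolding norm_add_scaleR_power2 by (simp add: power_mult_distrib)
  finally have "0 \<le> (\<eta>\<^sup>2 * (norm b)\<^sup>2 - 2 * \<eta> * (b \<bullet> g) + (norm g)\<^sup>2) / \<eta>"
    using \<eta>_bounds by simp
  also have "\<dots> = \<eta> * (norm b)\<^sup>2 - 2 * (b \<bullet> g) + (1 / \<eta>) * (norm g)\<^sup>2"
    using \<eta>_bounds by (simp add: field_simps power2_eq_square)
  finally have "(1 - \<eta>) * (norm b)\<^sup>2 - (1 / \<eta> - 1) * (norm g)\<^sup>2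
      \<le> (norm g)\<^sup>2 - 2 * (b \<bullet> g) + (norm b)\<^sup>2"
    by (simp add: algebra_simps)
  also have "\<dots> = (norm (g - b))\<^sup>2"
    by (simp add: power2_norm_eq_inner algebra_simps inner_commute)
  finally have "lam t * ((1 - \<eta>) * (norm b)\<^sup>2 - (1 / \<eta> - 1) * (norm g)\<^sup>2) \<le> lam t * (norm (g - b))\<^sup>2"
    using lam_pos[OF assms] by simp
  moreover have "lam t * (1 - \<eta>) = c * t\<^sup>2 / \<alpha>"
  proof -
    have "lam t * (1 - \<eta>) = t\<^sup>2 / \<alpha>\<^sup>2 * (c * \<alpha>)" using \<epsilon>_pos by (simp add: yosida_index_def \<eta>_def)
    also have "\<dots> = c * t\<^sup>2 / \<alpha>" using \<alpha>_gt by (simp add: power2_eq_square)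
    finally show ?thesis .
  qed
  moreover have "lam t * (1 / \<eta> - 1) = K * t\<^sup>2"
    by (simp add: yosida_index_def K_def)
  moreover have "lam t * ((1 - \<eta>) * (norm b)\<^sup>2 - (1 / \<eta> - 1) * (norm g)\<^sup>2)
      = lam t * (1 - \<eta>) * (norm b)\<^sup>2 - lam t * (1 / \<eta> - 1) * (norm g)\<^sup>2"
    unfolding right_diff_distrib[of "lam t" "(1 - \<eta>) * (norm b)\<^sup>2"] by (simp only: mult.assoc)
  ultimately show ?thesis by simp
qed

text \<open>
  The lower bound for \<open>t \<lambda> |y|\<^sup>2\<close> expands into a nonnegative multiple of \<open>|a|\<^sup>2\<close>, the term
  \<open>2 c t\<^sup>2 \<langle>v, a\<rangle>\<close>, which cancels against the derivative of \<open>c t\<^sup>2 |v|\<^sup>2\<close>, and \<open>c \<alpha> t |v|\<^sup>2\<close>. The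
  constant \<open>c\<close> is chosen so that the total coefficient of \<open>t |v|\<^sup>2\<close>, namely \<open>1 + 2 c - c \<alpha>\<close>,
  equals \<open>- 2/\<alpha>\<close>.
\<close>

lemma lyapunov_deriv_le:
  assumes t: "t\<^sub>0 < t" and a: "(v has_vector_derivative a) (at t)"
    and eq: "a + (\<alpha> / t) *\<^sub>R v t + y t = f t"
    and coercive: "lam t * (norm (y t))\<^sup>2 \<le> (x t - z) \<bullet> y t"
  shows "\<exists>d \<le> t * ((x t - z) \<bullet> f t) + K * cubic t - 2 / \<alpha> * kinetic t.
    (lyapunov z has_real_derivative d) (at t)"
proof (intro exI conjI)
  have t_pos: "0 < t" using t t0_pos by simp
  define d where "d = kinetic t + t * ((x t - z) \<bullet> f t) - t * ((x t - z) \<bullet> y t)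
      + c * (1 * (t * (v t \<bullet> v t)) + (1 * (v t \<bullet> v t) + (v t \<bullet> a + a \<bullet> v t) * t) * t)"
  show "(lyapunov z has_real_derivative d) (at t)"
    unfolding lyapunov_def[abs_def] d_def
    by (intro DERIV_add DERIV_mult DERIV_cmult DERIV_ident has_real_derivative_inner a
        anchor_deriv[OF t a eq])
  define b where "b = a + (\<alpha> / t) *\<^sub>R v t"
  have y: "y t = f t - b" using eq by (simp add: b_def algebra_simps)
  have "t * (c * t\<^sup>2 / \<alpha> * (norm b)\<^sup>2 - K * t\<^sup>2 * (norm (f t))\<^sup>2) \<le> t * ((x t - z) \<bullet> y t)"
    using lam_norm_ge[OF t_pos, of b "f t"] coercive t_pos unfolding y
    by (intro mult_left_mono) auto
  moreover have "t * (c * t\<^sup>2 / \<alpha> * (norm b)\<^sup>2 - K * t\<^sup>2 * (norm (f t))\<^sup>2)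
      = c * t ^ 3 / \<alpha> * (norm b)\<^sup>2 - K * cubic t"
    by (simp add: cubic_def power3_eq_cube power2_eq_square algebra_simps)
  moreover have "c * t ^ 3 / \<alpha> * (norm b)\<^sup>2
      = c * t ^ 3 / \<alpha> * (norm a)\<^sup>2 + 2 * c * t\<^sup>2 * (v t \<bullet> a) + c * \<alpha> * kinetic t"
    unfolding b_def norm_add_scaleR_power2
    using t_pos \<alpha>_gt by (simp add: kinetic_def inner_commute field_simps power3_eq_cube power2_eq_square)
  moreover have "0 \<le> c * t ^ 3 / \<alpha> * (norm a)\<^sup>2"
    using t_pos \<alpha>_gt by (simp add: c_def)
  moreover have "d =
      t * ((x t - z) \<bullet> f t) - t * ((x t - z) \<bullet> y t) + (1 + 2 * c) * kinetic t + 2 * c * t\<^sup>2 * (v t \<bullet> a)"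
    unfolding d_def kinetic_def power2_norm_eq_inner
    by (simp add: inner_commute algebra_simps power2_eq_square)
  ultimately have "d \<le> t * ((x t - z) \<bullet> f t) + K * cubic t + (1 + 2 * c - c * \<alpha>) * kinetic t"
    by (simp add: algebra_simps)
  also have "1 + 2 * c - c * \<alpha> = - 2 / \<alpha>"
  proof -
    have "1 + 2 * c - c * \<alpha> = 1 - c * (\<alpha> - 2)" by (simp add: algebra_simps)
    also have "c * (\<alpha> - 2) = (\<alpha> + 2) / \<alpha>" using \<alpha>_gt by (simp add: c_def)
    also have "1 - (\<alpha> + 2) / \<alpha> = - 2 / \<alpha>" using \<alpha>_gt by (simp add: field_simps)
    finally show ?thesis .
  qed
  finally show "d \<le> t * ((x t - z) \<bullet> f t) + K * cubic t - 2 / \<alpha> * kinetic t" by simp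
qed


lemma lyapunov_increment_le:
  assumes T: "t\<^sub>0 \<le> T" and M: "\<And>t. t \<in> {t\<^sub>0..T} \<Longrightarrow> norm (x t - z) \<le> M"
    and coercive: "\<And>t. t\<^sub>0 \<le> t \<Longrightarrow> lam t * (norm (y t))\<^sup>2 \<le> (x t - z) \<bullet> y t"
  shows "lyapunov z T + 2 / \<alpha> * integral {t\<^sub>0..T} kinetic
    \<le> lyapunov z t\<^sub>0 + M * integral {t\<^sub>0..T} forcing + K * integral {t\<^sub>0..T} cubic"
proof -
  define g where "g t = M * forcing t + K * cubic t - 2 / \<alpha> * kinetic t" for t
  have g: "(g has_integral (M * integral {t\<^sub>0..T} forcing + K * integral {t\<^sub>0..T} cubic
      - 2 / \<alpha> * integral {t\<^sub>0..T} kinetic)) {t\<^sub>0..T}"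
    unfolding g_def
    by (intro has_integral_diff has_integral_add has_integral_mult_right integrable_integral
        integrable_forcing integrable_cubic integrable_kinetic) simp_all
  have "lyapunov z T - lyapunov z t\<^sub>0 \<le> integral {t\<^sub>0..T} g"
  proof (rule absolutely_continuous_increment_le_integral[OF T lyapunov_ac])
    show "AE t in lebesgue. t\<^sub>0 < t \<and> t < T \<longrightarrow> (\<exists>d\<le>g t. (lyapunov z has_real_derivative d) (at t))"
      using ode
    proof eventually_elim
      case (elim t)
      show ?case
      proof
        assume t: "t\<^sub>0 < t \<and> t < T"
        with elim obtain a where a: "(v has_vector_derivative a) (at t)"
          "a + (\<alpha> / t) *\<^sub>R v t + y t = f t" by auto
        obtain d where d: "d \<le> t * ((x t - z) \<bullet> f t) + K * cubic t - 2 / \<alpha> * kinetic t"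
          "(lyapunov z has_real_derivative d) (at t)"
          using lyapunov_deriv_le[OF _ a coercive] t by auto
        have "t * ((x t - z) \<bullet> f t) \<le> M * forcing t"
          by (rule inner_forcing_le) (use t M in auto)
        with d show "\<exists>d\<le>g t. (lyapunov z has_real_derivative d) (at t)"
          by (intro exI[of _ d]) (auto simp: g_def)
      qed
    qed
  qed (use g in auto)
  with integral_unique[OF g] show ?thesis by simp
qed

lemma integrable_damping:
  assumes "t\<^sub>0 \<le> a"
  shows "(\<lambda>t. t * lam t * (norm (y t))\<^sup>2) integrable_on {a..b}"
  unfolding yosida_index_def using assms \<alpha>_gt
  by (intro integrable_continuous_real continuous_intros continuous_on_subset[OF y_cont]) auto

lemma anchor_increment_le:
  assumes s: "t\<^sub>0 \<le> s" "s \<le> T" and M: "\<And>t. t\<^sub>0 \<le> t \<Longrightarrow> norm (x t - z) \<le> M"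
    and coercive: "\<And>t. t\<^sub>0 \<le> t \<Longrightarrow> lam t * (norm (y t))\<^sup>2 \<le> (x t - z) \<bullet> y t"
  shows "anchor z T - anchor z s + integral {s..T} (\<lambda>t. t * lam t * (norm (y t))\<^sup>2)
    \<le> integral {s..T} kinetic + M * integral {s..T} forcing"
proof -
  define g where "g t = kinetic t + M * forcing t - t * lam t * (norm (y t))\<^sup>2" for t
  have g: "(g has_integral (integral {s..T} kinetic + M * integral {s..T} forcing
      - integral {s..T} (\<lambda>t. t * lam t * (norm (y t))\<^sup>2))) {s..T}"
    unfolding g_def
    by (intro has_integral_diff has_integral_add has_integral_mult_right integrable_integral
        integrable_forcing integrable_damping integrable_kinetic s(1))
  have "anchor z T - anchor z s \<le> integral {s..T} g"
  proof (rule absolutely_continuous_increment_le_integral[OF s(2) anchor_ac])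
    show "AE t in lebesgue. s < t \<and> t < T \<longrightarrow> (\<exists>d\<le>g t. (anchor z has_real_derivative d) (at t))"
      using ode
    proof eventually_elim
      case (elim t)
      show ?case
      proof
        assume t: "s < t \<and> t < T"
        with elim s obtain a where a: "(v has_vector_derivative a) (at t)"
          "a + (\<alpha> / t) *\<^sub>R v t + y t = f t" by auto
        have t': "t\<^sub>0 < t" "0 < t" using t s t0_pos by auto
        have "t * ((x t - z) \<bullet> f t) \<le> M * forcing t"
          by (rule inner_forcing_le) (use t' M in auto)
        moreover have "t * (lam t * (norm (y t))\<^sup>2) \<le> t * ((x t - z) \<bullet> y t)"
          using coercive[of t] t' by (intro mult_left_mono) auto
        ultimately have "kinetic t + t * ((x t - z) \<bullet> f t) - t * ((x t - z) \<bullet> y t) \<le> g t"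
          by (simp add: g_def mult.assoc)
        with anchor_deriv[OF t'(1) a] show "\<exists>d\<le>g t. (anchor z has_real_derivative d) (at t)" by blast
      qed
    qed
  qed (use g s in auto)
  with integral_unique[OF g] show ?thesis by simp
qed

text \<open>
  If \<open>m\<close> is the maximum of \<open>|x - z|\<close> over an interval starting at \<open>t\<^sub>0\<close>, the integrated Lyapunov
  inequality at the point where it is attained gives \<open>m\<^sup>2/4 \<le> C + m F\<close> with \<open>C\<close> and \<open>F\<close>
  independent of the interval. This bounds \<open>m\<close>, hence the Lyapunov function, hence the other two
  quantities.
\<close>

lemma energy_bounds:
  assumes coercive: "\<And>t. t\<^sub>0 \<le> t \<Longrightarrow> lam t * (norm (y t))\<^sup>2 \<le> (x t - z) \<bullet> y t"
  obtains B where "\<And>t. t\<^sub>0 \<le> t \<Longrightarrow> norm (x t - z) \<le> B"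
    "\<And>t. t\<^sub>0 \<le> t \<Longrightarrow> t * norm (v t) \<le> B"
    "\<And>t. t\<^sub>0 \<le> t \<Longrightarrow> integral {t\<^sub>0..t} kinetic \<le> B"
proof -
  define F where "F = integral {t\<^sub>0..} forcing"
  define C where "C = \<bar>lyapunov z t\<^sub>0\<bar> + K * integral {t\<^sub>0..} cubic"
  have F_nonneg: "0 \<le> F" unfolding F_def
    using set_lebesgue_integral_eq_integral(1)[OF f_linear]
    by (intro integral_nonneg forcing_nonneg) (auto simp: forcing_def[abs_def])
  have "0 \<le> integral {t\<^sub>0..} cubic"
    using set_lebesgue_integral_eq_integral(1)[OF f_cubic] t0_pos
    by (intro integral_nonneg) (auto simp: cubic_def[abs_def])
  then have C_nonneg: "0 \<le> C" using K_nonneg by (simp add: C_def)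
  have kinetic_nonneg: "0 \<le> integral {t\<^sub>0..T} kinetic" for T
    using t0_pos by (intro integral_nonneg integrable_kinetic) (auto simp: kinetic_def)
  have lyapunov_bound: "lyapunov z T + 2 / \<alpha> * integral {t\<^sub>0..T} kinetic \<le> C + M * F"
    if T: "t\<^sub>0 \<le> T" and M: "\<And>t. t \<in> {t\<^sub>0..T} \<Longrightarrow> norm (x t - z) \<le> M" for T M
  proof -
    have "0 \<le> M" using order_trans[OF norm_ge_zero M[of t\<^sub>0]] T by simp
    then have "M * integral {t\<^sub>0..T} forcing \<le> M * F"
      unfolding F_def by (intro mult_left_mono integral_forcing_le)
    moreover have "K * integral {t\<^sub>0..T} cubic \<le> K * integral {t\<^sub>0..} cubic"
      by (intro mult_left_mono integral_cubic_le K_nonneg)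
    ultimately show ?thesis
      using lyapunov_increment_le[OF T M coercive] unfolding C_def by linarith
  qed
  have x_lyapunov: "(norm (x t - z))\<^sup>2 / 4 \<le> lyapunov z t" if "t\<^sub>0 \<le> t" for t
  proof -
    have "0 \<le> (c - 1 / (\<alpha> - 1)) * (t * norm (v t))\<^sup>2" using c_gt by simp
    with lyapunov_lower[OF that, of z] show ?thesis by linarith
  qed
  \<comment> \<open>An explicit bound for the solutions \<open>m\<close> of \<open>m\<^sup>2 \<le> 4 C + 4 F m\<close>.\<close>
  define M where "M = 4 * C + 4 * F + 1"
  have x_bound: "norm (x T - z) \<le> M" if T: "t\<^sub>0 \<le> T" for T
  proof -
    have "\<exists>s\<in>{t\<^sub>0..T}. \<forall>t\<in>{t\<^sub>0..T}. norm (x t - z) \<le> norm (x s - z)"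
      using T by (intro continuous_attains_sup continuous_intros continuous_on_subset[OF x_cont]) auto
    then obtain s where s: "s \<in> {t\<^sub>0..T}" "\<And>t. t \<in> {t\<^sub>0..T} \<Longrightarrow> norm (x t - z) \<le> norm (x s - z)"
      by blast
    define m where "m = norm (x s - z)"
    have "lyapunov z s + 2 / \<alpha> * integral {t\<^sub>0..s} kinetic \<le> C + m * F"
      by (rule lyapunov_bound) (use s in \<open>auto simp: m_def\<close>)
    moreover have "0 \<le> 2 / \<alpha> * integral {t\<^sub>0..s} kinetic" using kinetic_nonneg \<alpha>_gt by simp
    moreover have "m\<^sup>2 / 4 \<le> lyapunov z s" unfolding m_def using s by (intro x_lyapunov) simp
    ultimately have m: "m * m \<le> 4 * C + 4 * F * m" by (simp add: power2_eq_square algebra_simps)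
    have "m \<le> M"
    proof (rule ccontr)
      assume "\<not> m \<le> M"
      then have gt: "4 * C + 4 * F + 1 < m" "1 < m" using C_nonneg F_nonneg by (auto simp: M_def)
      then have "(4 * C + 4 * F + 1) * m < m * m" by (intro mult_strict_right_mono) auto
      moreover have "4 * C * 1 \<le> 4 * C * m" using gt C_nonneg by (intro mult_left_mono) auto
      ultimately show False using m gt by (simp add: algebra_simps)
    qed
    with s(2)[of T] T show ?thesis by (simp add: m_def)
  qed
  define D where "D = C + M * F"
  have lyapunov_le: "lyapunov z T + 2 / \<alpha> * integral {t\<^sub>0..T} kinetic \<le> D" if "t\<^sub>0 \<le> T" for T
    unfolding D_def using that x_bound by (intro lyapunov_bound) auto
  define \<delta> where "\<delta> = c - 1 / (\<alpha> - 1)"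
  have \<delta>: "0 < \<delta>" using c_gt by (simp add: \<delta>_def)
  define B where "B = max M (max (sqrt (D / \<delta>)) (\<alpha> / 2 * D))"
  show thesis
  proof (rule that[of B])
    fix t assume t: "t\<^sub>0 \<le> t"
    show "norm (x t - z) \<le> B" using x_bound[OF t] by (simp add: B_def)
    have "0 \<le> 2 / \<alpha> * integral {t\<^sub>0..t} kinetic" using kinetic_nonneg \<alpha>_gt by simp
    moreover have "0 \<le> (norm (x t - z))\<^sup>2 / 4" by simp
    ultimately have "\<delta> * (t * norm (v t))\<^sup>2 \<le> D"
      using lyapunov_le[OF t] lyapunov_lower[OF t, of z] unfolding \<delta>_def by linarith
    then have "(t * norm (v t))\<^sup>2 \<le> D / \<delta>" using \<delta> by (simp add: field_simps)
    then have "t * norm (v t) \<le> sqrt (D / \<delta>)" by (rule real_le_rsqrt)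
    then show "t * norm (v t) \<le> B" by (simp add: B_def)
    have "0 \<le> lyapunov z t" using x_lyapunov[OF t] by (smt (verit) zero_le_power2 divide_nonneg_pos)
    then have "2 / \<alpha> * integral {t\<^sub>0..t} kinetic \<le> D" using lyapunov_le[OF t] by linarith
    then have "integral {t\<^sub>0..t} kinetic \<le> \<alpha> / 2 * D" using \<alpha>_gt by (simp add: field_simps)
    then show "integral {t\<^sub>0..t} kinetic \<le> B" by (simp add: B_def)
  qed
qed

lemma anchor_bound:
  assumes B: "norm (x t - z) \<le> B" "t * norm (v t) \<le> B" and t: "t\<^sub>0 \<le> t"
  shows "- (B * B) \<le> anchor z t"
proof -
  have "\<bar>t * ((x t - z) \<bullet> v t)\<bar> \<le> norm (x t - z) * (t * norm (v t))"
    using Cauchy_Schwarz_ineq2[of "x t - z" "v t"] t t0_pos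
    by (simp add: abs_mult mult.left_commute)
  also have "\<dots> \<le> B * B" using B t t0_pos order_trans[OF norm_ge_zero B(1)]
    by (intro mult_mono) auto
  finally have "- (B * B) \<le> t * ((x t - z) \<bullet> v t)" by linarith
  moreover have "0 \<le> (\<alpha> - 1) / 2 * ((x t - z) \<bullet> (x t - z))" using \<alpha>_gt by simp
  ultimately show ?thesis unfolding anchor_def by linarith
qed

lemma distance_tendsto_and_damping_bound:
  assumes coercive: "\<And>t. t\<^sub>0 \<le> t \<Longrightarrow> lam t * (norm (y t))\<^sup>2 \<le> (x t - z) \<bullet> y t"
  shows "\<exists>l. ((\<lambda>t. (norm (x t - z))\<^sup>2) \<longlongrightarrow> l) at_top"
    and "\<exists>D. \<forall>T\<ge>t\<^sub>0. integral {t\<^sub>0..T} (\<lambda>t. t * lam t * (norm (y t))\<^sup>2) \<le> D"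
proof -
  obtain B where B: "\<And>t. t\<^sub>0 \<le> t \<Longrightarrow> norm (x t - z) \<le> B" "\<And>t. t\<^sub>0 \<le> t \<Longrightarrow> t * norm (v t) \<le> B"
    "\<And>t. t\<^sub>0 \<le> t \<Longrightarrow> integral {t\<^sub>0..t} kinetic \<le> B"
    by (rule energy_bounds[OF coercive]) auto
  have B_nonneg: "0 \<le> B" using order_trans[OF norm_ge_zero B(1)[of t\<^sub>0]] by simp
  define G where "G t = integral {t\<^sub>0..t} kinetic + B * integral {t\<^sub>0..t} forcing" for t
  have G_diff: "G t - G s = integral {s..t} kinetic + B * integral {s..t} forcing"
    if "t\<^sub>0 \<le> s" "s \<le> t" for s t
    unfolding G_def
      Henstock_Kurzweil_Integration.integral_combine[OF that integrable_kinetic[OF order_refl], symmetric]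
      Henstock_Kurzweil_Integration.integral_combine[OF that integrable_forcing[OF order_refl], symmetric]
    by (simp add: distrib_left)
  have G_mono: "G s \<le> G t" if st: "t\<^sub>0 \<le> s" "s \<le> t" for s t
  proof -
    have "0 \<le> integral {s..t} kinetic"
      using st t0_pos by (intro integral_nonneg integrable_kinetic) (auto simp: kinetic_def)
    moreover have "0 \<le> integral {s..t} forcing"
      using st by (intro integral_nonneg integrable_forcing forcing_nonneg) auto
    ultimately have "0 \<le> G t - G s" unfolding G_diff[OF st] using B_nonneg by simp
    then show ?thesis by simp
  qed
  have G_bound: "G t \<le> B + B * integral {t\<^sub>0..} forcing" if "t\<^sub>0 \<le> t" for t
    unfolding G_def using B(3)[OF that] B_nonneg
    by (intro add_mono mult_left_mono integral_forcing_le) auto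
  have damping_nonneg: "0 \<le> integral {s..t} (\<lambda>t. t * lam t * (norm (y t))\<^sup>2)" if "t\<^sub>0 \<le> s" for s t
  proof (rule integral_nonneg[OF integrable_damping[OF that]])
    fix r assume "r \<in> {s..t}"
    then have "0 < r" using that t0_pos by auto
    then show "0 \<le> r * lam r * (norm (y r))\<^sup>2" using lam_pos[of r] by simp
  qed
  have anchor_lower: "- (B * B) \<le> anchor z t" if "t\<^sub>0 \<le> t" for t
    using anchor_bound B that by blast
  have anchor_incr: "anchor z t - anchor z s
      + integral {s..t} (\<lambda>t. t * lam t * (norm (y t))\<^sup>2) \<le> G t - G s"
    if "t\<^sub>0 \<le> s" "s \<le> t" for s t
    unfolding G_diff[OF that] by (rule anchor_increment_le[OF that B(1) coercive])
  obtain q where q: "(anchor z \<longlongrightarrow> q) at_top"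
  proof (rule bounded_increments_tendsto[of t\<^sub>0 "anchor z" G])
    show "anchor z t - anchor z s \<le> G t - G s" if "t\<^sub>0 \<le> s" "s \<le> t" for s t
      using anchor_incr[OF that] damping_nonneg[OF that(1), of t] by linarith
  qed (use G_mono G_bound anchor_lower in auto)
  have "((\<lambda>t. (x t - z) \<bullet> (x t - z) / 2) \<longlongrightarrow> q / (\<alpha> - 1)) at_top"
  proof (rule tendsto_of_weighted_derivative[of _ t\<^sub>0 _ "\<lambda>t. (x t - z) \<bullet> v t"])
    fix t assume t: "t\<^sub>0 < t"
    have X: "((\<lambda>t. x t - z) has_vector_derivative v t) (at t)"
      using has_vector_derivative_diff[OF x_deriv_at[OF t] has_vector_derivative_const[of z]] by simp
    from DERIV_cdivide[OF has_real_derivative_inner[OF X X], of 2]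
    show "((\<lambda>t. (x t - z) \<bullet> (x t - z) / 2) has_real_derivative (x t - z) \<bullet> v t) (at t)"
      by (simp add: inner_commute[of "v t"])
  next
    show "((\<lambda>t. t * ((x t - z) \<bullet> v t) + (\<alpha> - 1) * ((x t - z) \<bullet> (x t - z) / 2)) \<longlongrightarrow> q) at_top"
      using q unfolding anchor_def[abs_def] by simp
  qed (use \<alpha>_gt in auto)
  from tendsto_mult_left[OF this, of 2]
  show "\<exists>l. ((\<lambda>t. (norm (x t - z))\<^sup>2) \<longlongrightarrow> l) at_top"
    by (auto simp: power2_norm_eq_inner)
  have "integral {t\<^sub>0..T} (\<lambda>t. t * lam t * (norm (y t))\<^sup>2)
      \<le> B + B * integral {t\<^sub>0..} forcing - G t\<^sub>0 + anchor z t\<^sub>0 + B * B" if "t\<^sub>0 \<le> T" for T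
    using anchor_incr[OF order_refl that] G_bound[OF that] anchor_lower[OF that] by linarith
  then show "\<exists>D. \<forall>T\<ge>t\<^sub>0. integral {t\<^sub>0..T} (\<lambda>t. t * lam t * (norm (y t))\<^sup>2) \<le> D" by blast
qed


lemma displacement_le:
  assumes t: "t\<^sub>0 \<le> t" and coercive: "lam t * (norm (y t))\<^sup>2 \<le> (x t - z) \<bullet> y t"
  shows "norm (lam t *\<^sub>R y t) \<le> norm (x t - z)"
proof (cases "y t = 0")
  case False
  have "lam t * (norm (y t))\<^sup>2 \<le> norm (x t - z) * norm (y t)"
    using coercive norm_cauchy_schwarz by (rule order_trans)
  then have "lam t * norm (y t) * norm (y t) \<le> norm (x t - z) * norm (y t)"
    by (simp add: power2_eq_square mult.assoc)
  with False lam_pos[of t] t t0_pos show ?thesis by simp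
qed auto

text \<open>
  The displacement is Lipschitz in \<open>log t\<close>: \<open>x\<close> is, since \<open>t |v|\<close> is bounded, and the relative
  change of the index between \<open>s\<close> and \<open>t\<close> is at most \<open>2 (t - s)/s\<close>. Its square divided by \<open>t\<close> is a
  constant multiple of the integrable quantity \<open>t \<lambda> |y|\<^sup>2\<close>.
\<close>

lemma displacement_tendsto_0:
  assumes coercive: "\<And>t. t\<^sub>0 \<le> t \<Longrightarrow> lam t * (norm (y t))\<^sup>2 \<le> (x t - z) \<bullet> y t"
    and dist: "\<And>s t. t\<^sub>0 \<le> s \<Longrightarrow> t\<^sub>0 \<le> t \<Longrightarrow> norm (lam s *\<^sub>R y s - lam t *\<^sub>R y t)
        \<le> norm (x s - x t) + 2 * \<bar>lam t / lam s - 1\<bar> * norm (lam s *\<^sub>R y s)"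
  shows "((\<lambda>t. lam t *\<^sub>R y t) \<longlongrightarrow> 0) at_top"
proof -
  define \<psi> where "\<psi> t = norm (lam t *\<^sub>R y t)" for t
  obtain B where B: "\<And>t. t\<^sub>0 \<le> t \<Longrightarrow> norm (x t - z) \<le> B" "\<And>t. t\<^sub>0 \<le> t \<Longrightarrow> t * norm (v t) \<le> B"
    by (rule energy_bounds[OF coercive]) auto
  have B_nonneg: "0 \<le> B" using order_trans[OF norm_ge_zero B(1)[of t\<^sub>0]] by simp
  obtain D where D: "\<And>T. t\<^sub>0 \<le> T \<Longrightarrow> integral {t\<^sub>0..T} (\<lambda>t. t * lam t * (norm (y t))\<^sup>2) \<le> D"
    using distance_tendsto_and_damping_bound(2)[OF coercive] by blast
  define k where "k = (1 + \<epsilon>) / \<alpha>\<^sup>2"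
  have k: "0 \<le> k" using \<epsilon>_pos by (simp add: k_def)
  have lam_k: "lam t = k * t\<^sup>2" for t by (simp add: yosida_index_def k_def)
  have "(\<psi> \<longlongrightarrow> 0) at_top"
  proof (rule log_lipschitz_tendsto_0[OF t0_pos, of "5 * B" \<psi> "k * D"])
    fix s t assume s: "t\<^sub>0 \<le> s" "s \<le> t"
    then have pos: "0 < s" "0 < t" using t0_pos by auto
    have x_diff: "norm (x t - x s) \<le> B / s * (t - s)"
    proof (rule x_increment[OF s])
      fix r assume r: "r \<in> {s..t}"
      then have "norm (v r) * s \<le> r * norm (v r)"
        by (simp add: mult.commute[of _ s] mult_right_mono)
      also have "\<dots> \<le> B" using r s by (intro B) simp
      finally show "norm (v r) \<le> B / s" using pos by (simp add: pos_le_divide_eq)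
    qed
    have lam_ratio: "\<bar>lam s / lam t - 1\<bar> \<le> 2 * (t - s) / s"
    proof -
      have "k \<noteq> 0" using \<epsilon>_pos \<alpha>_gt by (simp add: k_def)
      then have "lam s / lam t - 1 = - ((t - s) / t * ((t + s) / t))"
        using pos by (simp add: lam_k field_simps power2_eq_square)
      then have "\<bar>lam s / lam t - 1\<bar> = (t - s) / t * ((t + s) / t)"
        using s pos by (simp add: abs_mult)
      also have "\<dots> \<le> (t - s) / s * 2"
        using s pos by (intro mult_mono divide_left_mono) (auto simp: divide_le_eq)
      finally show ?thesis by (simp add: mult.commute)
    qed
    have "\<psi> t \<le> B" unfolding \<psi>_def
      using displacement_le[OF _ coercive, of t] B(1)[of t] s by (meson order_trans)
    have "\<bar>\<psi> t - \<psi> s\<bar> \<le> norm (lam t *\<^sub>R y t - lam s *\<^sub>R y s)"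
      unfolding \<psi>_def by (rule norm_triangle_ineq3)
    also have "\<dots> \<le> norm (x t - x s) + 2 * \<bar>lam s / lam t - 1\<bar> * \<psi> t"
      unfolding \<psi>_def using s by (intro dist) auto
    also have "\<dots> \<le> B / s * (t - s) + 2 * (2 * (t - s) / s) * B"
      using x_diff lam_ratio \<open>\<psi> t \<le> B\<close> s pos
      by (intro add_mono mult_mono mult_left_mono) (auto simp: \<psi>_def)
    also have "\<dots> = 5 * B * (t - s) / s" using pos by (simp add: field_simps)
    finally show "\<bar>\<psi> t - \<psi> s\<bar> \<le> 5 * B * (t - s) / s" .
  next
    show "continuous_on {t\<^sub>0..} \<psi>"
      unfolding \<psi>_def lam_k by (intro continuous_intros y_cont)
  next
    fix T assume T: "t\<^sub>0 \<le> T"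
    have "integral {t\<^sub>0..T} (\<lambda>s. (\<psi> s)\<^sup>2 / s)
        = integral {t\<^sub>0..T} (\<lambda>s. k * (s * lam s * (norm (y s))\<^sup>2))"
    proof (rule integral_cong)
      fix s assume "s \<in> {t\<^sub>0..T}"
      then have "0 < s" using t0_pos by simp
      then show "(\<psi> s)\<^sup>2 / s = k * (s * lam s * (norm (y s))\<^sup>2)"
        using k by (simp add: \<psi>_def lam_k power_mult_distrib power2_eq_square)
    qed
    also have "\<dots> \<le> k * D" using D[OF T] k by (simp add: mult_left_mono)
    finally show "integral {t\<^sub>0..T} (\<lambda>s. (\<psi> s)\<^sup>2 / s) \<le> k * D" .
  qed (use B_nonneg in simp)
  then show ?thesis unfolding \<psi>_def by (rule tendsto_norm_zero_cancel)
qed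

end

section \<open>Weak convergence of the trajectory\<close>

text \<open>
  Passing to the limit in \<open>0 \<le> \<langle>x - \<xi> - y', u - v'\<rangle>\<close> shows that \<open>\<langle>x, v'\<rangle>\<close> is eventually at most
  \<open>\<langle>y', v'\<rangle> + e\<close>. This is a half-space condition on \<open>x\<close>, so it is inherited by \<open>w\<close>, and it says
  that \<open>(w, 0)\<close> is monotonically related to the graph.
\<close>

lemma graph_limit_mem_zeros:
  fixes A :: "'a::{real_inner,complete_space} \<Rightarrow> 'a set"
  assumes A: "maximally_monotone_op A"
    and graph: "\<forall>\<^sub>F t in at_top. u t \<in> A (x t - \<xi> t)"
    and \<xi>: "((\<lambda>t. \<xi> t) \<longlongrightarrow> 0) at_top" and u: "(u \<longlongrightarrow> 0) at_top"
    and bound: "\<forall>\<^sub>F t in at_top. norm (x t) \<le> B"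
    and w: "\<And>y c. \<forall>\<^sub>F t in at_top. (x t :: 'a) \<bullet> y \<le> c \<Longrightarrow> w \<bullet> y \<le> c"
  shows "w \<in> op_inverse A (0 :: 'a)"
proof -
  have "0 \<in> A w"
  proof (rule maximally_monotone_op_memI[OF A])
    fix y' v' assume v': "v' \<in> A y'"
    have "w \<bullet> v' \<le> y' \<bullet> v' + e" if e: "0 < e" for e
    proof (rule w)
      have lim: "((\<lambda>t. (B + norm (\<xi> t) + norm y') * norm (u t) + norm (\<xi> t) * norm v')
          \<longlongrightarrow> (B + norm (0::'a) + norm y') * norm (0::'a) + norm (0::'a) * norm v') at_top"
        by (intro tendsto_intros \<xi> u)
      then have "\<forall>\<^sub>F t in at_top. (B + norm (\<xi> t) + norm y') * norm (u t) + norm (\<xi> t) * norm v' < e"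
        by (rule order_tendstoD) (use e in simp)
      with graph bound show "\<forall>\<^sub>F t in at_top. x t \<bullet> v' \<le> y' \<bullet> v' + e"
      proof eventually_elim
        case (elim t)
        have "0 \<le> (x t - \<xi> t - y') \<bullet> (u t - v')"
          using A elim(1) v' unfolding maximally_monotone_op_def monotone_op_def by blast
        then have "x t \<bullet> v' \<le> y' \<bullet> v' + ((x t - \<xi> t - y') \<bullet> u t + \<xi> t \<bullet> v')"
          by (simp add: inner_diff_left inner_diff_right)
        also have "(x t - \<xi> t - y') \<bullet> u t \<le> norm (x t - \<xi> t - y') * norm (u t)"
          by (rule norm_cauchy_schwarz)
        also have "norm (x t - \<xi> t - y') * norm (u t) \<le> (B + norm (\<xi> t) + norm y') * norm (u t)"
          using elim(2) norm_triangle_ineq4[of "x t - \<xi> t" y'] norm_triangle_ineq4[of "x t" "\<xi> t"]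
          by (intro mult_right_mono) auto
        also have "\<xi> t \<bullet> v' \<le> norm (\<xi> t) * norm v'" by (rule norm_cauchy_schwarz)
        finally show ?case using elim(3) by simp
      qed
    qed
    then have "w \<bullet> v' \<le> y' \<bullet> v'" by (rule field_le_epsilon)
    then show "0 \<le> (w - y') \<bullet> (0 - v')" by (simp add: inner_diff_left inner_diff_right)
  qed
  then show ?thesis by (simp add: op_inverse_def)
qed

theorem theorem4p1:
  fixes A :: "'a::{real_inner, complete_space} \<Rightarrow> 'a set"
    and f x :: "real \<Rightarrow> 'a"
    and t\<^sub>0 \<alpha> \<epsilon> :: real
  assumes "maximally_monotone_op A"
    and "op_inverse A 0 \<noteq> {}"
    and "t\<^sub>0 > 0"
    and "\<alpha> > 2"
    and "\<epsilon> > 4 / (\<alpha> - 2)"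
    and "locally_integrable_on f {t\<^sub>0..}"
    and "set_integrable lebesgue {t\<^sub>0..} (\<lambda>t. t ^ 3 * (norm (f t))\<^sup>2)"
    and "set_integrable lebesgue {t\<^sub>0..} (\<lambda>t. t * norm (f t))"
    and "strong_global_solution A \<alpha> (\<lambda>t. (1 + \<epsilon>) * (t\<^sup>2 / \<alpha>\<^sup>2)) f t\<^sub>0 x"
  shows "(\<exists>z \<in> op_inverse A 0. weakly_tendsto x z at_top) \<and>
         (\<lambda>t. norm (velocity t\<^sub>0 x t)) \<in> O[at_top](\<lambda>t. 1 / t)"
proof -
  note A = assms(1)
  define v where "v = velocity t\<^sub>0 x"
  define lam where "lam = yosida_index \<alpha> \<epsilon>"
  define y where "y t = yosida A (lam t) (x t)" for t
  define \<xi> where "\<xi> t = lam t *\<^sub>R y t" for t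
  have \<epsilon>: "0 < \<epsilon>" using assms(4,5) by (smt (verit) divide_pos_pos)
  have lam_pos: "0 < lam t" if "t\<^sub>0 \<le> t" for t
    using that assms(3,4) \<epsilon> by (simp add: lam_def yosida_index_def)
  note sol = assms(9)[unfolded strong_global_solution_def]
  have x_deriv: "(x has_vector_derivative v t) (at t within {t\<^sub>0..})" if "t\<^sub>0 \<le> t" for t
  proof -
    have "x differentiable (at t within {t\<^sub>0..})"
      using sol that by (simp add: differentiable_on_def)
    then show ?thesis by (simp add: v_def velocity_def vector_derivative_works)
  qed
  have v_cont: "continuous_on {t\<^sub>0..} v" using sol by (simp add: v_def)
  have v_ac: "absolutely_continuous_on_Icc a b v" if "t\<^sub>0 \<le> a" for a b
  proof -
    have "{a..b} \<subseteq> {t\<^sub>0..}" using that by auto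
    then show ?thesis using sol unfolding locally_absolutely_continuous_on_def v_def by blast
  qed
  have ode: "AE t in lebesgue. t > t\<^sub>0 \<longrightarrow>
        (\<exists>a. (v has_vector_derivative a) (at t) \<and> a + (\<alpha> / t) *\<^sub>R v t + y t = f t)"
    using sol by (simp add: v_def y_def lam_def yosida_index_def)
  have \<xi>_dist: "norm (\<xi> s - \<xi> t) \<le> norm (x s - x t) + 2 * \<bar>lam t / lam s - 1\<bar> * norm (\<xi> s)"
    if "t\<^sub>0 \<le> s" "t\<^sub>0 \<le> t" for s t
    unfolding \<xi>_def y_def using that by (intro yosida_displacement_dist[OF A] lam_pos)
  have x_cont: "continuous_on {t\<^sub>0..} x"
    unfolding continuous_on_eq_continuous_within
    by (intro ballI has_vector_derivative_continuous[OF x_deriv]) simp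
  have \<xi>_cont: "continuous_on {t\<^sub>0..} \<xi>"
    unfolding continuous_on_def
  proof
    fix s assume s: "s \<in> {t\<^sub>0..}"
    have lim: "((\<lambda>t. norm (x s - x t) + 2 * \<bar>lam t / lam s - 1\<bar> * norm (\<xi> s))
        \<longlongrightarrow> norm (x s - x s) + 2 * \<bar>lam s / lam s - 1\<bar> * norm (\<xi> s)) (at s within {t\<^sub>0..})"
      using x_cont s lam_pos[of s] assms(4) unfolding continuous_on_def
      by (intro tendsto_intros) (auto simp: lam_def yosida_index_def intro!: tendsto_intros)
    have "((\<lambda>t. \<xi> s - \<xi> t) \<longlongrightarrow> 0) (at s within {t\<^sub>0..})"
    proof (rule Lim_null_comparison)
      show "\<forall>\<^sub>F t in at s within {t\<^sub>0..}. norm (\<xi> s - \<xi> t)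
          \<le> norm (x s - x t) + 2 * \<bar>lam t / lam s - 1\<bar> * norm (\<xi> s)"
        unfolding eventually_at_filter using \<xi>_dist s by (intro always_eventually) auto
      show "((\<lambda>t. norm (x s - x t) + 2 * \<bar>lam t / lam s - 1\<bar> * norm (\<xi> s)) \<longlongrightarrow> 0) (at s within {t\<^sub>0..})"
        using lim lam_pos[of s] s by simp
    qed
    from tendsto_diff[OF tendsto_const[of "\<xi> s"] this]
    show "(\<xi> \<longlongrightarrow> \<xi> s) (at s within {t\<^sub>0..})" by simp
  qed
  have y_\<xi>: "y t = (1 / lam t) *\<^sub>R \<xi> t" if "t\<^sub>0 \<le> t" for t
    using lam_pos[OF that] by (simp add: \<xi>_def)
  have lam_cont: "continuous_on S lam" for S
    using assms(4) unfolding lam_def yosida_index_def[abs_def] by (intro continuous_intros) auto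
  have "continuous_on {t\<^sub>0..} (\<lambda>t. (1 / lam t) *\<^sub>R \<xi> t)"
    by (intro continuous_intros \<xi>_cont lam_cont) (use lam_pos in force)
  then have y_cont: "continuous_on {t\<^sub>0..} y"
    by (rule continuous_on_eq) (simp add: y_\<xi>)
  interpret T: damped_trajectory x v y f t\<^sub>0 \<alpha> \<epsilon>
    by unfold_locales (fact assms x_deriv v_cont v_ac y_cont ode)+
  have coercive: "yosida_index \<alpha> \<epsilon> t * (norm (y t))\<^sup>2 \<le> (x t - z) \<bullet> y t"
    if "z \<in> op_inverse A 0" "t\<^sub>0 \<le> t" for z t
    using yosida_cocoercive_at_zero[OF A lam_pos[OF that(2)] that(1)] by (simp add: y_def lam_def)
  obtain z where z: "z \<in> op_inverse A 0" using assms(2) by blast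
  obtain B where x_bound: "\<And>t. t\<^sub>0 \<le> t \<Longrightarrow> norm (x t - z) \<le> B"
      and v_bound: "\<And>t. t\<^sub>0 \<le> t \<Longrightarrow> t * norm (v t) \<le> B"
    by (rule T.energy_bounds[OF coercive[OF z]]) auto
  have after: "\<forall>\<^sub>F t in at_top. t\<^sub>0 \<le> t" by (rule eventually_ge_at_top)
  have bounded: "\<forall>\<^sub>F t in at_top. norm (x t) \<le> B + norm z"
    using after
  proof eventually_elim
    case (elim t)
    show ?case using x_bound[OF elim] norm_triangle_sub[of "x t" z] by linarith
  qed
  have \<xi>_lim: "(\<xi> \<longlongrightarrow> 0) at_top"
    unfolding \<xi>_def[abs_def] lam_def
    using T.displacement_tendsto_0[OF coercive[OF z]] \<xi>_dist[unfolded \<xi>_def lam_def] by blast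
  have y_lim: "(y \<longlongrightarrow> 0) at_top"
  proof -
    have "((\<lambda>t. (\<alpha>\<^sup>2 / (1 + \<epsilon>) * (inverse t * inverse t)) *\<^sub>R \<xi> t)
        \<longlongrightarrow> (\<alpha>\<^sup>2 / (1 + \<epsilon>) * (0 * 0)) *\<^sub>R 0) at_top"
      by (intro tendsto_intros \<xi>_lim tendsto_inverse_0_at_top filterlim_ident)
    moreover have "\<forall>\<^sub>F t in at_top. (\<alpha>\<^sup>2 / (1 + \<epsilon>) * (inverse t * inverse t)) *\<^sub>R \<xi> t = y t"
      using after
    proof eventually_elim
      case (elim t)
      have "\<alpha>\<^sup>2 / (1 + \<epsilon>) * (inverse t * inverse t) = 1 / lam t"
        by (simp add: lam_def yosida_index_def field_simps power2_eq_square)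
      then show ?case using y_\<xi>[OF elim] by simp
    qed
    ultimately show ?thesis by (simp add: Lim_transform_eventually)
  qed
  have "\<exists>z\<in>op_inverse A 0. weakly_tendsto x z at_top"
  proof (rule Opial_weak_convergence[OF bounded])
    show "\<exists>l. ((\<lambda>t. (norm (x t - z))\<^sup>2) \<longlongrightarrow> l) at_top" if "z \<in> op_inverse A 0" for z
      by (rule T.distance_tendsto_and_damping_bound(1)[OF coercive[OF that]])
    have graph: "\<forall>\<^sub>F t in at_top. y t \<in> A (x t - \<xi> t)"
      using after
    proof eventually_elim
      case (elim t)
      show ?case unfolding y_def \<xi>_def by (rule yosida_mem[OF A lam_pos[OF elim]])
    qed
    show "w \<in> op_inverse A 0" if "\<And>y c. \<forall>\<^sub>F t in at_top. x t \<bullet> y \<le> c \<Longrightarrow> w \<bullet> y \<le> c" for w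
      by (rule graph_limit_mem_zeros[OF A graph \<xi>_lim y_lim bounded that])
  qed
  moreover have "(\<lambda>t. norm (velocity t\<^sub>0 x t)) \<in> O(\<lambda>t. 1 / t)"
  proof (rule bigoI[of _ B])
    show "\<forall>\<^sub>F t in at_top. norm (norm (velocity t\<^sub>0 x t)) \<le> B * norm (1 / t)"
      using after
    proof eventually_elim
      case (elim t)
      with assms(3) have "0 < t" by simp
      with v_bound[OF elim] show ?case by (simp add: v_def field_simps)
    qed
  qed
  ultimately show ?thesis by blast
qed

end
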